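(* Let $2\le\xi<\omega_1$. Then there exists a partial function $f:\mathbb{Z}_+^\omega\times 2^\omega\rightarrowtail\mathbb{Z}^\omega$ satisfying: (i) $f$ is $\mathbf{\Sigma}^0_\xi$-measurable and $\mathrm{graph}(f)$ is the difference of two $\mathbf{\Pi}^0_\xi$ subsets of $\mathbb{Z}_+^\omega\times 2^\omega\times\mathbb{Z}^\omega$; (ii) for all $(a,x)\in\mathbb{Z}_+^\omega\times 2^\omega$, if $(a,x)\in\mathrm{dom}(f)$ then $f(a,x)\in\mathrm{supp}\,\mu_a$; (iii) for every $a\in\mathbb{Z}_+^\omega$ and every $S\in\mathbf{\Pi}^0_\xi(2^\omega\times\mathbb{Z}^\omega)$, if $\mathrm{graph}(f_a)\subseteq S$ then there exists $x\in 2^\omega$ with $\mu_a(S_x)>0$, where $f_a:2^\omega\rightarrowtail\mathbb{Z}^\omega$ is the partial function $f_a(x)=f(a,x)$ and $S_x=\{g\in\mathbb{Z}^\omega:(x,g)\in S\}$.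
   Context: $\mathbb{Z}_+$ is the set of positive integers; $\mathbb{Z}_+^\omega$, $\mathbb{Z}^\omega$ carry the product of discrete topologies and $2^\omega$ is the Cantor space. A partial function $f:X\rightarrowtail Y$ is $\mathbf{\Sigma}^0_\xi$-measurable if the preimages of open subsets of $Y$ are $\mathbf{\Sigma}^0_\xi$ subsets of $X$. For a positive integer $k$, $\varrho_k$ is the uniform probability measure on $\llbracket 0,k\rrbracket=[0,k]\cap\mathbb{Z}$, i.e. $\varrho_k(X)=\frac{|X\cap\llbracket 0,k\rrbracket|}{k+1}$ for $X\subseteq\mathbb{Z}$. For $a\in\mathbb{Z}_+^\omega$, $\mu_a=\bigotimes_{n\in\omega}\varrho_{a(n)}$ is the product Borel probability measure on $\mathbb{Z}^\omega$; its support is $\mathrm{supp}\,\mu_a=\prod_{n\in\omega}\llbracket 0,a(n)\rrbracket$. *)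

theory Defs
  imports "HOL-Analysis.Analysis" "HOL-Probability.Probability"
begin

text \<open>Countable ordinals xi < omega_1 are represented by well-orders r :: nat rel
(the order type of r is xi).  The additive Borel class Sigma^0_xi of a topological
space X is defined by the usual recursion:
  Sigma^0_1 = open sets,
  Sigma^0_xi = countable unions of sets whose complements are in Sigma^0_eta, 1 <= eta < xi
(open sets belong to every Sigma^0_xi with xi >= 1).  Order type >= 1 means Field r nonempty.\<close>

inductive borel_sigma :: "'a topology \<Rightarrow> nat rel \<Rightarrow> 'a set \<Rightarrow> bool" for X where
  sigma_open: "Field r \<noteq> {} \<Longrightarrow> openin X S \<Longrightarrow> borel_sigma X r S"
| sigma_union: "(\<forall>n::nat. A n \<subseteq> topspace X \<and>
      (\<exists>r' :: nat rel. (r', r) \<in> ordLess \<and> Field r' \<noteq> {} \<and> borel_sigma X r' (topspace X - A n)))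
    \<Longrightarrow> borel_sigma X r (\<Union>n::nat. A n)"

definition borel_pi :: "'a topology \<Rightarrow> nat rel \<Rightarrow> 'a set \<Rightarrow> bool" where
  "borel_pi X r S \<longleftrightarrow> S \<subseteq> topspace X \<and> borel_sigma X r (topspace X - S)"

definition Zpos_omega :: "(nat \<Rightarrow> int) topology" where
  "Zpos_omega = product_topology (\<lambda>_. discrete_topology {k::int. k > 0}) UNIV"

definition Cantor :: "(nat \<Rightarrow> bool) topology" where
  "Cantor = product_topology (\<lambda>_. discrete_topology (UNIV :: bool set)) UNIV"

definition Z_omega :: "(nat \<Rightarrow> int) topology" where
  "Z_omega = product_topology (\<lambda>_. discrete_topology (UNIV :: int set)) UNIV"

definition varrho :: "int \<Rightarrow> int measure" where
  "varrho k = measure_pmf (pmf_of_set {0..k})"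

definition mu :: "(nat \<Rightarrow> int) \<Rightarrow> (nat \<Rightarrow> int) measure" where
  "mu a = (\<Pi>\<^sub>M n\<in>UNIV. varrho (a n))"

definition supp_mu :: "(nat \<Rightarrow> int) \<Rightarrow> (nat \<Rightarrow> int) set" where
  "supp_mu a = {g. \<forall>n. 0 \<le> g n \<and> g n \<le> a n}"

definition pgraph :: "('a \<Rightarrow> 'b option) \<Rightarrow> ('a \<times> 'b) set" where
  "pgraph f = {(p, y). f p = Some y}"

definition sigma_measurable_partial ::
    "'a topology \<Rightarrow> 'b topology \<Rightarrow> nat rel \<Rightarrow> ('a \<Rightarrow> 'b option) \<Rightarrow> bool" where
  "sigma_measurable_partial X Y r f \<longleftrightarrow>
     dom f \<subseteq> topspace X \<and> ran f \<subseteq> topspace Y \<and>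
     (\<forall>U. openin Y U \<longrightarrow> borel_sigma X r {p. \<exists>y. f p = Some y \<and> y \<in> U})"

end

theory Submission
  imports Defs
begin

text \<open>If \<open>W\<close> is a universal \<open>\<Sigma>\<^sub>\<xi>\<close> set and \<open>V = {((a, x), g). (x, x, g) \<in> W}\<close>, then it suffices to
  uniformize \<open>V\<close> over the parameters \<open>(a, x)\<close> whose section of \<open>V\<close> is not \<open>\<mu>\<^sub>a\<close>-null: if all sections of
  a \<open>\<Pi>\<^sub>\<xi>\<close> set \<open>S\<close> containing the graph of \<open>f\<^sub>a\<close> were null and \<open>x\<close> is a code of the complement of \<open>S\<close>,
  then \<open>f(a, x)\<close> would be defined and lie outside \<open>S\<^sub>x\<close>.

  To uniformize without raising the complexity, one shows by induction that every \<open>\<Pi>\<^sub>\<eta>\<close> set \<open>B\<close> contains,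
  for each \<open>\<epsilon> > 0\<close>, compact sets \<open>K(p) \<subseteq> B\<^sub>p\<close> with \<open>\<mu>\<^sub>a(B\<^sub>p - K(p)) \<le> \<epsilon>\<close> such that \<open>{p. K(p) \<subseteq> U}\<close> is
  \<open>\<Sigma>\<^sub>\<eta>\<close> for all open \<open>U\<close>. In the inductive step \<open>B\<close> is an intersection of sets \<open>S\<^sub>n\<close> of lower classes; each
  \<open>S\<^sub>n\<close> is approximated by a compact set whose index is chosen measurably by the reduction property, and
  the chosen compact sets are intersected. Since \<open>V\<close> is a countable union of sets of lower
  dual classes, such a \<open>K(p)\<close> that is nonempty can be found measurably, and \<open>f(p)\<close> is its leftmost point.\<close>

unbundle cardinal_syntax

section \<open>Borel classes\<close>

lemma borel_sigma_subset: "borel_sigma X r S \<Longrightarrow> S \<subseteq> topspace X"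
  by (induction rule: borel_sigma.induct) (auto dest: openin_subset)

lemma Field_nonempty_ordLeq:
  assumes "r \<le>o r'" "Field r \<noteq> {}"
  shows "Field r' \<noteq> {}"
proof -
  obtain f where "Well_order r" "embed r r' f"
    using assms(1) unfolding ordLeq_def by auto
  then show ?thesis
    using embed_Field[of r r' f] assms(2) by (auto simp: image_subset_iff)
qed

lemma borel_sigma_Field:
  assumes "borel_sigma X r S"
  shows "Field r \<noteq> {}"
  using assms
proof (cases rule: borel_sigma.cases)
  case (sigma_union A)
  then obtain r' :: "nat rel" where "r' <o r" "Field r' \<noteq> {}" by blast
  then show ?thesis using Field_nonempty_ordLeq ordLess_imp_ordLeq by blast
qed auto

text \<open>Only the bounds \<open>r' <o r\<close> mention the order, so the class depends on the
  order type alone; with \<open>=o\<close> this also transports sets between isomorphic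
  orders.\<close>

lemma borel_sigma_mono:
  assumes "borel_sigma X r S" "r \<le>o r'"
  shows "borel_sigma X r' S"
  using assms(1)
proof cases
  case sigma_open
  then show ?thesis
    using Field_nonempty_ordLeq[OF assms(2)] borel_sigma.sigma_open by blast
next
  case (sigma_union A)
  then show ?thesis
    using ordLess_ordLeq_trans[OF _ assms(2)] borel_sigma.sigma_union[of A X r'] by blast
qed

lemma borel_sigma_mono_less:
  "borel_sigma X r S \<Longrightarrow> r <o r' \<Longrightarrow> borel_sigma X r' S"
  by (blast intro: borel_sigma_mono ordLess_imp_ordLeq)

lemma borel_sigma_compl:
  assumes "borel_sigma X r' S" "r' <o r"
  shows "borel_sigma X r (topspace X - S)"
proof -
  have "topspace X - (topspace X - S) = S"
    using borel_sigma_subset[OF assms(1)] by auto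
  then have "borel_sigma X r (\<Union>n::nat. topspace X - S)"
    using assms borel_sigma_Field[OF assms(1)]
    by (intro borel_sigma.sigma_union) auto
  then show ?thesis by simp
qed

lemma openin_Union_closedin_sequence:
  assumes "metrizable_space X" "openin X U"
  obtains C :: "nat \<Rightarrow> 'a set" where "\<And>n. closedin X (C n)" "U = (\<Union>n. C n)"
proof -
  obtain C :: "nat \<Rightarrow> 'a set" where "\<forall>n. closedin X (C n)" "(\<Union>n. C n) = U"
    using open_imp_fsigma_in[OF assms] unfolding fsigma_in_ascending by blast
  then show ?thesis by (intro that[of C]) auto
qed

text \<open>Unifies the two introduction rules: once a nonempty order \<open>r1\<close> lies below
  \<open>r\<close>, an open set of a metrizable space, being a countable union of closed sets, has
  the same form as a set built by \<open>sigma_union\<close>.\<close>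

lemma borel_sigma_limit_rep:
  fixes r r1 :: "nat rel"
  assumes X: "metrizable_space X" and r1: "r1 <o r" "Field r1 \<noteq> {}"
    and S: "borel_sigma X r S"
  obtains A where "S = (\<Union>n::nat. A n)" "\<And>n. A n \<subseteq> topspace X"
    "\<And>n. \<exists>r' :: nat rel. r' <o r \<and> borel_sigma X r' (topspace X - A n)"
  using S
proof cases
  case sigma_open
  obtain C :: "nat \<Rightarrow> 'a set" where C: "\<And>n. closedin X (C n)" "S = (\<Union>n. C n)"
    using openin_Union_closedin_sequence[OF X sigma_open(2)] by metis
  have "borel_sigma X r1 (topspace X - C n)" for n
    using C(1)[of n] r1 by (intro borel_sigma.sigma_open) auto
  with C r1 show ?thesis
    by (intro that[of C]) (auto dest: closedin_subset)
next
  case (sigma_union A)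
  then show ?thesis by (intro that[of A]) auto
qed

text \<open>With a smaller class available, the double sequence of pieces is re-enumerated by
  \<open>prod_decode\<close>. Otherwise \<open>sigma_union\<close> cannot have been applied, so all
  the sets are open.\<close>

lemma borel_sigma_UN_nat:
  fixes S :: "nat \<Rightarrow> 'a set"
  assumes X: "metrizable_space X" and S: "\<And>n. borel_sigma X r (S n)"
  shows "borel_sigma X r (\<Union>n. S n)"
proof (cases "\<exists>r1 :: nat rel. r1 <o r \<and> Field r1 \<noteq> {}")
  case True
  then obtain r1 :: "nat rel" where r1: "r1 <o r" "Field r1 \<noteq> {}" by auto
  have "\<exists>A. S n = (\<Union>m::nat. A m) \<and> (\<forall>m. A m \<subseteq> topspace X \<and>
    (\<exists>r' :: nat rel. r' <o r \<and> borel_sigma X r' (topspace X - A m)))" for n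
    using borel_sigma_limit_rep[OF X r1 S[of n]] by metis
  then obtain A where A: "\<And>n. S n = (\<Union>m::nat. A n m)"
    "\<And>n m. A n m \<subseteq> topspace X \<and> (\<exists>r' :: nat rel. r' <o r \<and> borel_sigma X r' (topspace X - A n m))"
    by metis
  have "borel_sigma X r (\<Union>k::nat. (case prod_decode k of (n, m) \<Rightarrow> A n m))"
    using A(2) borel_sigma_Field
    by (intro borel_sigma.sigma_union) (fastforce split: prod.split)
  moreover have "(\<Union>k::nat. (case prod_decode k of (n, m) \<Rightarrow> A n m)) = (\<Union>n. S n)"
  proof -
    have "x \<in> (\<Union>k::nat. (case prod_decode k of (n, m) \<Rightarrow> A n m))" if "x \<in> A n m" for x n m
      using that by (auto intro!: exI[of _ "prod_encode (n, m)"])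
    then show ?thesis unfolding A(1) by (auto split: prod.splits)
  qed
  ultimately show ?thesis by simp
next
  case False
  have "openin X (S n)" for n
    using S[of n] False by cases auto
  then show ?thesis
    using borel_sigma_Field[OF S[of 0]] by (intro borel_sigma.sigma_open) auto
qed

lemma borel_sigma_empty: "Field r \<noteq> {} \<Longrightarrow> borel_sigma X r {}"
  by (intro borel_sigma.sigma_open) auto

lemma borel_sigma_UN:
  assumes X: "metrizable_space X" and I: "countable I" and r: "Field r \<noteq> {}"
    and S: "\<And>i. i \<in> I \<Longrightarrow> borel_sigma X r (S i)"
  shows "borel_sigma X r (\<Union>i\<in>I. S i)"
proof (cases "I = {}")
  case True
  then show ?thesis using borel_sigma_empty[OF r] by simp
next
  case False
  then have "(\<Union>i\<in>I. S i) = (\<Union>n. S (from_nat_into I n))"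
    using I by (metis image_image range_from_nat_into)
  with borel_sigma_UN_nat[OF X, of r "\<lambda>n. S (from_nat_into I n)"] S from_nat_into[OF False]
  show ?thesis by simp
qed

lemma borel_sigma_Un:
  assumes "metrizable_space X" "borel_sigma X r S" "borel_sigma X r T"
  shows "borel_sigma X r (S \<union> T)"
  using borel_sigma_UN[OF assms(1), of "UNIV :: bool set" r "\<lambda>b. if b then S else T"]
    assms borel_sigma_Field[OF assms(2)] by (simp add: UNIV_bool Un_commute)

lemma ordLess_max:
  fixes r r1 r2 :: "nat rel"
  assumes "r1 <o r" "r2 <o r"
  obtains r' :: "nat rel" where "r' <o r" "r1 \<le>o r'" "r2 \<le>o r'"
proof -
  have "Well_order r1" "Well_order r2"
    using assms unfolding ordLess_def by auto
  then show ?thesis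
    using that[of r1] that[of r2] assms ordLeq_total[of r1 r2] ordLeq_reflexive by blast
qed

text \<open>Intersection distributes over the two unions. The complement of
  \<open>A n \<inter> B m\<close> is a union of two sets that both belong to the larger of their
  classes, which is still below \<open>r\<close>.\<close>

lemma borel_sigma_Int:
  assumes X: "metrizable_space X" and S: "borel_sigma X r S" and T: "borel_sigma X r T"
  shows "borel_sigma X r (S \<inter> T)"
proof (cases "\<exists>r1 :: nat rel. r1 <o r \<and> Field r1 \<noteq> {}")
  case True
  then obtain r1 :: "nat rel" where r1: "r1 <o r" "Field r1 \<noteq> {}" by auto
  obtain A where A: "S = (\<Union>n::nat. A n)" "\<And>n. A n \<subseteq> topspace X"
    "\<And>n. \<exists>r' :: nat rel. r' <o r \<and> borel_sigma X r' (topspace X - A n)"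
    using borel_sigma_limit_rep[OF X r1 S] by metis
  obtain B where B: "T = (\<Union>n::nat. B n)" "\<And>n. B n \<subseteq> topspace X"
    "\<And>n. \<exists>r' :: nat rel. r' <o r \<and> borel_sigma X r' (topspace X - B n)"
    using borel_sigma_limit_rep[OF X r1 T] by metis
  have "borel_sigma X r (A n \<inter> B m)" for n m
  proof -
    obtain r2 r3 :: "nat rel" where r2: "r2 <o r" "borel_sigma X r2 (topspace X - A n)"
      and r3: "r3 <o r" "borel_sigma X r3 (topspace X - B m)"
      using A(3) B(3) by metis
    obtain r' :: "nat rel" where r': "r' <o r" "r2 \<le>o r'" "r3 \<le>o r'"
      using ordLess_max[OF r2(1) r3(1)] by metis
    have "borel_sigma X r' ((topspace X - A n) \<union> (topspace X - B m))"
      using borel_sigma_mono r2(2) r3(2) r'(2,3) by (intro borel_sigma_Un[OF X]) blast+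
    then have "borel_sigma X r (topspace X - ((topspace X - A n) \<union> (topspace X - B m)))"
      using r'(1) by (rule borel_sigma_compl)
    also have "topspace X - ((topspace X - A n) \<union> (topspace X - B m)) = A n \<inter> B m"
      using A(2)[of n] B(2)[of m] by auto
    finally show ?thesis .
  qed
  then have "borel_sigma X r (\<Union>(n, m)\<in>UNIV. A n \<inter> B m)"
    by (intro borel_sigma_UN[OF X] borel_sigma_Field[OF S]) auto
  also have "(\<Union>(n, m)\<in>UNIV. A n \<inter> B m) = S \<inter> T"
    unfolding A(1) B(1) by auto
  finally show ?thesis .
next
  case False
  have "openin X S"
    using S False by cases auto
  moreover have "openin X T"
    using T False by cases auto
  ultimately show ?thesis
    using borel_sigma_Field[OF S] by (intro borel_sigma.sigma_open) auto
qed

lemma borel_sigma_INT: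
  assumes X: "metrizable_space X" and I: "finite I" and r: "Field r \<noteq> {}"
    and S: "\<And>i. i \<in> I \<Longrightarrow> borel_sigma X r (S i)"
  shows "borel_sigma X r (topspace X \<inter> (\<Inter>i\<in>I. S i))"
  using I S
proof (induction I rule: finite_induct)
  case empty
  then show ?case using r by (auto intro: borel_sigma.sigma_open)
next
  case (insert i I)
  then have "borel_sigma X r (S i \<inter> (topspace X \<inter> (\<Inter>i\<in>I. S i)))"
    by (blast intro: borel_sigma_Int[OF X])
  moreover have "S i \<inter> (topspace X \<inter> (\<Inter>i\<in>I. S i)) = topspace X \<inter> (\<Inter>i\<in>insert i I. S i)"
    by auto
  ultimately show ?case by simp
qed

lemma borel_sigma_vimage:
  assumes "continuous_map X Y h" "borel_sigma Y r S"
  shows "borel_sigma X r {x \<in> topspace X. h x \<in> S}"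
  using assms(2)
proof (induction rule: borel_sigma.induct)
  case (sigma_open r S)
  then show ?case
    using openin_continuous_map_preimage[OF assms(1)] by (intro borel_sigma.sigma_open)
next
  case (sigma_union A r)
  have h: "h x \<in> topspace Y" if "x \<in> topspace X" for x
    using assms(1) that by (auto simp: continuous_map_def)
  have "topspace X - {x \<in> topspace X. h x \<in> A n} = {x \<in> topspace X. h x \<in> topspace Y - A n}" for n
    using h by auto
  with sigma_union have "borel_sigma X r (\<Union>n. {x \<in> topspace X. h x \<in> A n})"
    by (intro borel_sigma.sigma_union) (force simp del: Diff_iff)
  moreover have "(\<Union>n. {x \<in> topspace X. h x \<in> A n}) = {x \<in> topspace X. h x \<in> (\<Union>n. A n)}"
    by auto
  ultimately show ?case by simp
qed

text \<open>The larger of the two points cuts off a proper initial segment, which is a smaller order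
  and contains the other point.\<close>

lemma ex_smaller_nonempty_order:
  fixes r :: "nat rel"
  assumes r: "Well_order r" and ij: "i \<in> Field r" "j \<in> Field r" "i \<noteq> j"
  obtains r1 :: "nat rel" where "r1 <o r" "Field r1 \<noteq> {}"
proof -
  note that' = that
  have *: thesis if "(i, j) \<in> r" "i \<in> Field r" "j \<in> Field r" "i \<noteq> j" for i j
  proof -
    let ?r = "Restr r (underS r j)"
    have "?r <o r"
      using underS_Restr_ordLess[OF r] \<open>i \<in> Field r\<close> by auto
    moreover have "(i, i) \<in> ?r"
      using r \<open>i \<in> Field r\<close> \<open>(i, j) \<in> r\<close> \<open>i \<noteq> j\<close>
      by (auto simp: underS_def order_on_defs refl_on_def)
    then have "Field ?r \<noteq> {}" by (metis FieldI1 empty_iff)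
    ultimately show thesis by (rule that')
  qed
  have "(i, j) \<in> r \<or> (j, i) \<in> r"
    using r ij by (auto simp: order_on_defs total_on_def)
  then show thesis using * ij by metis
qed

section \<open>Universal sets\<close>

lemma topspace_Cantor [simp]: "topspace Cantor = UNIV"
  by (simp add: Cantor_def)

text \<open>Row \<open>n\<close> of a point of \<open>Cantor\<close> viewed as a matrix through the
  pairing function: one code thereby carries a whole sequence of codes.\<close>

definition code_section :: "nat \<Rightarrow> (nat \<Rightarrow> bool) \<Rightarrow> nat \<Rightarrow> bool" where
  "code_section n x k = x (prod_encode (n, k))"

lemma ex_code: "\<exists>x. \<forall>n. code_section n x = xs n"
  by (rule exI[of _ "\<lambda>j. case prod_decode j of (n, k) \<Rightarrow> xs n k"])
    (simp add: code_section_def fun_eq_iff)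

lemma continuous_map_code_section:
  "continuous_map Cantor Cantor (code_section n)"
  unfolding Cantor_def code_section_def[abs_def]
  by (auto simp: continuous_map_componentwise_UNIV intro: continuous_map_product_projection)

lemma openin_Cantor_coordinate: "openin Cantor {x. x k}"
proof -
  have "continuous_map Cantor (discrete_topology UNIV) (\<lambda>x. x k)"
    unfolding Cantor_def by (rule continuous_map_product_projection) simp
  from openin_continuous_map_preimage[OF this, of "{True}"] show ?thesis by simp
qed

lemma second_countable_sequence:
  assumes "second_countable X"
  obtains B :: "nat \<Rightarrow> 'a set" where "\<And>n. openin X (B n)"
    "\<And>U. openin X U \<Longrightarrow> U = (\<Union>n\<in>{n. B n \<subseteq> U}. B n)"
proof -
  obtain \<B> where \<B>: "countable \<B>" "\<forall>V\<in>\<B>. openin X V"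
    "\<forall>U x. openin X U \<and> x \<in> U \<longrightarrow> (\<exists>V\<in>\<B>. x \<in> V \<and> V \<subseteq> U)"
    using assms unfolding second_countable_def by (elim exE conjE)
  \<comment> \<open>The empty set is added so that the enumerated family is nonempty; it changes no
    union.\<close>
  define B where "B = from_nat_into (insert {} \<B>)"
  have r: "range B = insert {} \<B>"
    unfolding B_def using \<B>(1) by (intro range_from_nat_into) auto
  show thesis
  proof (rule that)
    show "openin X (B n)" for n
    proof -
      have "B n \<in> insert {} \<B>" using r by auto
      then show ?thesis using \<B>(2) by auto
    qed
    show "U = (\<Union>n\<in>{n. B n \<subseteq> U}. B n)" if U: "openin X U" for U
    proof
      show "U \<subseteq> (\<Union>n\<in>{n. B n \<subseteq> U}. B n)"
      proof
        fix x assume "x \<in> U"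
        then obtain V where "V \<in> \<B>" "x \<in> V" "V \<subseteq> U" using \<B>(3) U by blast
        moreover obtain n where "V = B n" using r \<open>V \<in> \<B>\<close> by blast
        ultimately show "x \<in> (\<Union>n\<in>{n. B n \<subseteq> U}. B n)" by auto
      qed
    qed auto
  qed
qed

lemma metrizable_space_Cantor: "metrizable_space Cantor"
  unfolding Cantor_def metrizable_space_product_topology by auto

text \<open>A code for a \<open>\<Sigma>\<^sub>r\<close> set lists the basic open sets that it contains, and codes of complements
  of sets of the classes of the proper initial segments of \<open>r\<close>, each of which is used infinitely
  often; slots that are not needed hold a code of the whole space.\<close>

lemma ex_universal_borel_sigma:
  fixes Z :: "'a topology" and r :: "nat rel"
  assumes Z: "metrizable_space Z" "second_countable Z"
    and "Well_order r" "Field r \<noteq> {}"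
  shows "\<exists>W. borel_sigma (prod_topology Cantor Z) r W \<and>
    (\<forall>S. borel_sigma Z r S \<longrightarrow> (\<exists>x. S = {z. (x, z) \<in> W}))"
  using assms(3,4)
proof (induction r rule: wf_induct_rule[OF wf_ordLess])
  case (1 r)
  let ?X = "prod_topology Cantor Z"
  have X: "metrizable_space ?X"
    using Z(1) metrizable_space_Cantor by (simp add: metrizable_space_prod_topology)
  obtain B :: "nat \<Rightarrow> 'a set" where B: "\<And>n. openin Z (B n)"
    "\<And>U. openin Z U \<Longrightarrow> U = (\<Union>n\<in>{n. B n \<subseteq> U}. B n)"
    using second_countable_sequence[OF Z(2)] by blast
  \<comment> \<open>The proper initial segments of \<open>r\<close> represent all smaller order
    types up to isomorphism, so the classes below \<open>r\<close> are indexed by the countable set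
    \<open>Field r\<close>.\<close>
  define R where "R i = Restr r (underS r i)" for i
  define I where "I = {(i, n :: nat). i \<in> Field r \<and> Field (R i) \<noteq> {}}"
  have R: "R i <o r" if "i \<in> Field r" for i
    using underS_Restr_ordLess[OF 1(2)] that unfolding R_def by auto
  have "\<exists>W. borel_sigma ?X (R i) W \<and> (\<forall>S. borel_sigma Z (R i) S \<longrightarrow> (\<exists>x. S = {z. (x, z) \<in> W}))"
    if "i \<in> Field r" "Field (R i) \<noteq> {}" for i
    using 1(1)[OF R[OF that(1)]] that(2) R[OF that(1)] unfolding ordLess_def by auto
  then obtain W where
    W1: "\<And>i. i \<in> Field r \<Longrightarrow> Field (R i) \<noteq> {} \<Longrightarrow> borel_sigma ?X (R i) (W i)" and
    W2: "\<And>i S. i \<in> Field r \<Longrightarrow> Field (R i) \<noteq> {} \<Longrightarrow> borel_sigma Z (R i) S \<Longrightarrow> \<exists>x. S = {z. (x, z) \<in> W i}"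
    by metis
  \<comment> \<open>Row 0 of a code governs the open part; slot \<open>(i, n)\<close> uses row
    \<open>Suc (prod_encode (i, n))\<close>, hence the shift by one.\<close>
  define h where "h j p = (code_section j (fst p), snd p)" for j and p :: "(nat \<Rightarrow> bool) \<times> 'a"
  have h: "continuous_map ?X ?X (h j)" for j
    unfolding h_def
    by (intro continuous_map_pairedI continuous_map_snd
        continuous_map_compose[OF continuous_map_fst continuous_map_code_section, unfolded comp_def])
  define V where "V = (\<Union>n. {p \<in> topspace ?X. code_section 0 (fst p) n \<and> snd p \<in> B n}) \<union>
    (\<Union>(i, n)\<in>I. topspace ?X - {p \<in> topspace ?X. h (Suc (prod_encode (i, n))) p \<in> W i})"
  have "borel_sigma ?X r V"
    unfolding V_def
  proof (rule borel_sigma_Un[OF X])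
    show "borel_sigma ?X r (\<Union>n. {p \<in> topspace ?X. code_section 0 (fst p) n \<and> snd p \<in> B n})"
    proof (intro borel_sigma.sigma_open 1(3) openin_Union, clarify)
      fix n
      have "{p \<in> topspace ?X. code_section 0 (fst p) n \<and> snd p \<in> B n} = {x. x (prod_encode (0, n))} \<times> B n"
        using openin_subset[OF B(1)[of n]] by (auto simp: code_section_def)
      then show "openin ?X {p \<in> topspace ?X. code_section 0 (fst p) n \<and> snd p \<in> B n}"
        using openin_Cantor_coordinate B(1) by (simp add: openin_prod_Times_iff)
    qed
    have "borel_sigma ?X r (case j of (i, n) \<Rightarrow> topspace ?X -
        {p \<in> topspace ?X. h (Suc (prod_encode (i, n))) p \<in> W i})" if jI: "j \<in> I" for j
    proof -
      obtain i n where j: "j = (i, n)" "i \<in> Field r" "Field (R i) \<noteq> {}"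
        using jI unfolding I_def by blast
      show ?thesis
        unfolding j prod.case
        by (rule borel_sigma_compl[OF borel_sigma_vimage[OF h W1] R]) (use j in auto)
    qed
    then show "borel_sigma ?X r (\<Union>(i, n)\<in>I. topspace ?X -
        {p \<in> topspace ?X. h (Suc (prod_encode (i, n))) p \<in> W i})"
      by (intro borel_sigma_UN[OF X _ 1(3)]) auto
  qed
  have slice: "\<exists>x. {z. (x, z) \<in> V} = (\<Union>n\<in>N. B n) \<union> (\<Union>(i, n)\<in>I. topspace Z - T i n)"
    if T: "\<And>i n. (i, n) \<in> I \<Longrightarrow> borel_sigma Z (R i) (T i n)" for N T
  proof -
    have "\<exists>x. T i n = {z. (x, z) \<in> W i}" if "(i, n) \<in> I" for i n
      using W2 T that unfolding I_def by auto
    then obtain y where y: "\<And>i n. (i, n) \<in> I \<Longrightarrow> T i n = {z. (y i n, z) \<in> W i}"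
      by metis
    obtain x where x: "\<And>n. code_section n x =
        (case n of 0 \<Rightarrow> (\<lambda>k. k \<in> N) | Suc j \<Rightarrow> (\<lambda>(i, n). y i n) (prod_decode j))"
      using ex_code[of "\<lambda>n. case n of 0 \<Rightarrow> (\<lambda>k. k \<in> N) | Suc j \<Rightarrow> (\<lambda>(i, n). y i n) (prod_decode j)"]
      by blast
    have "(x, z) \<in> V \<longleftrightarrow> z \<in> (\<Union>n\<in>N. B n) \<union> (\<Union>(i, n)\<in>I. topspace Z - T i n)" for z
    proof -
      have UN2: "q \<in> (\<Union>(i, n)\<in>I. F i n) \<longleftrightarrow> (\<exists>i n. (i, n) \<in> I \<and> q \<in> F i n)" for q :: 'c and F
        by auto
      have "(x, z) \<in> V \<longleftrightarrow> (\<exists>n\<in>N. z \<in> topspace Z \<and> z \<in> B n) \<or>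
          (\<exists>i n. (i, n) \<in> I \<and> z \<in> topspace Z \<and> (y i n, z) \<notin> W i)"
        unfolding V_def Un_iff UN2 by (auto simp: x h_def)
      also have "\<dots> \<longleftrightarrow> (\<exists>n\<in>N. z \<in> B n) \<or> (\<exists>i n. (i, n) \<in> I \<and> z \<in> topspace Z - T i n)"
        using openin_subset[OF B(1)] y by blast
      finally show ?thesis unfolding Un_iff UN2 by simp
    qed
    then show ?thesis by blast
  qed
  have "\<exists>x. S = {z. (x, z) \<in> V}" if "borel_sigma Z r S" for S
    using that
  proof cases
    case sigma_open
    obtain x where "{z. (x, z) \<in> V} =
        (\<Union>n\<in>{n. B n \<subseteq> S}. B n) \<union> (\<Union>(i, n)\<in>I. topspace Z - topspace Z)"
      using slice[of "\<lambda>_ _. topspace Z" "{n. B n \<subseteq> S}"] by (auto simp: I_def intro: borel_sigma.sigma_open)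
    then show ?thesis using B(2)[OF sigma_open(2)] by auto
  next
    case (sigma_union A)
    have "\<exists>i. i \<in> Field r \<and> Field (R i) \<noteq> {} \<and> borel_sigma Z (R i) (topspace Z - A n)" for n
    proof -
      obtain r' :: "nat rel" where r': "r' <o r" "borel_sigma Z r' (topspace Z - A n)"
        using sigma_union(2) by blast
      moreover from r' have "Well_order r'" unfolding ordLess_def by auto
      ultimately obtain i where i: "i \<in> Field r" "r' =o R i"
        using ordLess_iff_ordIso_Restr[OF 1(2)] unfolding R_def by metis
      then have "borel_sigma Z (R i) (topspace Z - A n)"
        using r'(2) borel_sigma_mono ordIso_iff_ordLeq by blast
      then show ?thesis using i(1) borel_sigma_Field by metis
    qed
    then obtain \<iota> where \<iota>: "\<And>n. \<iota> n \<in> Field r" "\<And>n. Field (R (\<iota> n)) \<noteq> {}"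
      "\<And>n. borel_sigma Z (R (\<iota> n)) (topspace Z - A n)"
      by metis
    \<comment> \<open>Several \<open>A n\<close> may have the same index \<open>\<iota> n\<close>;
      the second coordinate gives each its own slot, and a slot holding the whole space contributes
      nothing.\<close>
    define T where "T i n = (if i = \<iota> n then topspace Z - A n else topspace Z)" for i n
    have "borel_sigma Z (R i) (T i n)" if "(i, n) \<in> I" for i n
      using that \<iota>(3) unfolding T_def I_def by (auto intro: borel_sigma.sigma_open)
    then obtain x where x: "{z. (x, z) \<in> V} = (\<Union>n\<in>{}. B n) \<union> (\<Union>(i, n)\<in>I. topspace Z - T i n)"
      using slice[of T "{}"] by blast
    have "A n \<subseteq> topspace Z" for n
      using sigma_union(2) by blast
    then have T': "topspace Z - T i n = (if i = \<iota> n then A n else {})" for i n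
      by (auto simp: T_def)
    have "(\<iota> n, n) \<in> I" for n
      using \<iota>(1,2) by (simp add: I_def)
    then have "(\<Union>(i, n)\<in>I. topspace Z - T i n) = S"
      unfolding sigma_union(1) T' by (force split: if_splits)
    with x show ?thesis by auto
  qed
  with \<open>borel_sigma ?X r V\<close> show ?case by blast
qed

section \<open>Cylinders and product measures\<close>

text \<open>Every set in a discrete space is a union of singletons. The resulting instances for
  \<open>int\<close> and \<open>bool\<close> pass to the sequence spaces, as
  \<open>sets_PiM_equal_borel\<close> and the construction of universal sets require.\<close>

lemma ex_countable_generating_singletons:
  "\<exists>B :: 'a::{countable, discrete_topology} set set. countable B \<and> open = generate_topology B"
proof (intro exI conjI ext iffI)
  let ?B = "range (\<lambda>x :: 'a. {x})"
  fix S :: "'a set"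
  have "generate_topology ?B (\<Union>x\<in>S. {x})"
    by (intro generate_topology_Union generate_topology.Basis) auto
  then show "generate_topology ?B S" by simp
qed (auto intro: Topological_Spaces.open_discrete)

instance int :: second_countable_topology
  by standard (rule ex_countable_generating_singletons)

instance bool :: second_countable_topology
  by standard (rule ex_countable_generating_singletons)

lemma discrete_topology_UNIV_eq:
  "discrete_topology (UNIV :: 'a::discrete_topology set) = euclidean"
  unfolding topology_eq by (auto simp flip: open_openin intro: Topological_Spaces.open_discrete)

lemma Z_omega_eq: "Z_omega = euclidean"
  unfolding Z_omega_def discrete_topology_UNIV_eq euclidean_product_topology ..

lemma Cantor_eq: "Cantor = euclidean"
  unfolding Cantor_def discrete_topology_UNIV_eq euclidean_product_topology ..

lemma second_countable_euclidean:
  "second_countable (euclidean :: 'a::second_countable_topology topology)"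
proof -
  obtain B :: "'a set set" where "countable B" "topological_basis B"
    using ex_countable_basis by blast
  then show ?thesis
    unfolding second_countable_def
    by (intro exI[of _ B]) (metis open_openin topological_basisE topological_basis_open)
qed

lemma topspace_Zpos_omega [simp]: "topspace Zpos_omega = {a. \<forall>n. a n > 0}"
  by (auto simp: Zpos_omega_def)

lemma metrizable_space_Zpos_omega: "metrizable_space Zpos_omega"
  unfolding Zpos_omega_def metrizable_space_product_topology by auto

text \<open>The box around \<open>a\<close> that fixes the first \<open>n\<close> coordinates stays
  inside the set.\<close>

lemma openin_Zpos_omega_initial_segment:
  assumes "\<And>a b. (\<forall>i<n. a i = b i) \<Longrightarrow> P a \<Longrightarrow> P b"
  shows "openin Zpos_omega {a \<in> topspace Zpos_omega. P a}"
proof (subst openin_subopen, clarify)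
  fix a assume a: "a \<in> topspace Zpos_omega" "P a"
  let ?X = "\<lambda>i. if i < n then {a i} else {k. k > 0}"
  have "finite {i. ?X i \<noteq> {k. k > 0}}"
    by (rule finite_subset[of _ "{..<n}"]) auto
  then have "openin Zpos_omega (PiE UNIV ?X)"
    unfolding Zpos_omega_def using a by (subst openin_PiE_gen) auto
  moreover have "P b" if "b \<in> PiE UNIV ?X" for b
    using assms[OF _ a(2)] that by (auto simp: PiE_iff split: if_splits)
  moreover have "PiE UNIV ?X \<subseteq> topspace Zpos_omega"
  proof
    fix b assume "b \<in> PiE UNIV ?X"
    then have "b i \<in> ?X i" for i by (auto simp: PiE_iff)
    then have "b i > 0" for i
      using a(1) by (metis (mono_tags, lifting) mem_Collect_eq singletonD topspace_Zpos_omega)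
    then show "b \<in> topspace Zpos_omega" by simp
  qed
  ultimately show "\<exists>T. openin Zpos_omega T \<and> a \<in> T \<and> T \<subseteq> {a \<in> topspace Zpos_omega. P a}"
    using a by (intro exI[of _ "PiE UNIV ?X"]) auto
qed

section \<open>Cylinders and finite unions of cylinders\<close>

definition cyl :: "int list \<Rightarrow> (nat \<Rightarrow> int) set" where
  "cyl l = {g. \<forall>i<length l. g i = l ! i}"

text \<open>Lists of lists index these clopen sets so that there are only countably many, and unions
  over all of them stay within a Borel class.\<close>

definition clop :: "int list list \<Rightarrow> (nat \<Rightarrow> int) set" where
  "clop L = (\<Union>l\<in>set L. cyl l)"

lemma mem_cyl_restrict:
  "h \<in> cyl (map g [0..<n]) \<longleftrightarrow> (\<forall>i<n. h i = g i)"
  by (simp add: cyl_def)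

lemma continuous_coordinate: "continuous_on UNIV (\<lambda>g :: nat \<Rightarrow> int. g i)"
  by (rule continuous_on_product_coordinates)

lemma cyl_eq: "cyl l = (\<Inter>i\<in>{..<length l}. (\<lambda>g. g i) -` {l ! i})"
  by (auto simp: cyl_def)

lemma open_cyl: "open (cyl l)"
  unfolding cyl_eq
  by (intro open_INT ballI open_vimage continuous_coordinate) (auto intro: Topological_Spaces.open_discrete)

lemma closed_cyl: "closed (cyl l)"
  unfolding cyl_eq
  by (intro closed_INT ballI closed_vimage continuous_coordinate) auto

lemma open_clop: "open (clop L)" and closed_clop: "closed (clop L)"
  unfolding clop_def using open_cyl closed_cyl by auto

lemma open_contains_cyl:
  assumes "open U" "g \<in> U"
  obtains n where "cyl (map g [0..<n]) \<subseteq> U"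
proof -
  have "openin (product_topology (\<lambda>_. euclidean) UNIV) U"
    using assms(1) by (simp add: euclidean_product_topology)
  from product_topology_open_contains_basis[OF this assms(2)]
  obtain X where X: "g \<in> PiE UNIV X" "finite {i. X i \<noteq> UNIV}" "PiE UNIV X \<subseteq> U"
    by auto
  obtain n where n: "\<And>i. X i \<noteq> UNIV \<Longrightarrow> i < n"
    using X(2) unfolding finite_nat_set_iff_bounded by auto
  have "cyl (map g [0..<n]) \<subseteq> PiE UNIV X"
  proof
    fix h assume "h \<in> cyl (map g [0..<n])"
    then have "\<And>i. i < n \<Longrightarrow> h i = g i" by (simp add: mem_cyl_restrict)
    then have "h i \<in> X i" for i
      using n[of i] X(1) by (cases "i < n") (auto simp: PiE_iff)
    then show "h \<in> PiE UNIV X" by (simp add: PiE_iff)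
  qed
  with X(3) show thesis by (intro that) auto
qed

lemma compact_subset_clop:
  assumes K: "compact K" and V: "open V" and KV: "K \<subseteq> V"
  obtains L where "K \<subseteq> clop L" "clop L \<subseteq> V"
proof -
  have "\<exists>C'\<subseteq>{l. cyl l \<subseteq> V}. finite C' \<and> K \<subseteq> (\<Union>l\<in>C'. cyl l)"
  proof (rule compactE_image[OF K])
    show "K \<subseteq> (\<Union>l\<in>{l. cyl l \<subseteq> V}. cyl l)"
    proof
      fix g assume "g \<in> K"
      then obtain n where "cyl (map g [0..<n]) \<subseteq> V"
        using open_contains_cyl[OF V] KV by blast
      moreover have "g \<in> cyl (map g [0..<n])" by (simp add: mem_cyl_restrict)
      ultimately show "g \<in> (\<Union>l\<in>{l. cyl l \<subseteq> V}. cyl l)" by blast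
    qed
  qed (auto intro: open_cyl)
  then obtain C where C: "C \<subseteq> {l. cyl l \<subseteq> V}" "finite C" "K \<subseteq> (\<Union>l\<in>C. cyl l)" by blast
  obtain L where "set L = C" using finite_list[OF C(2)] by blast
  with C show thesis by (intro that[of L]) (auto simp: clop_def)
qed

section \<open>Supports and product measures\<close>

lemma supp_mu_eq: "supp_mu a = PiE UNIV (\<lambda>n. {0..a n})"
  by (auto simp: supp_mu_def PiE_iff)

lemma compact_supp_mu: "compact (supp_mu a)"
proof -
  have "compactin (product_topology (\<lambda>_. euclidean) UNIV) (PiE UNIV (\<lambda>n. {0..a n}))"
    unfolding compactin_PiE by (auto intro: finite_imp_compact)
  then show ?thesis
    by (simp add: euclidean_product_topology supp_mu_eq)
qed

lemma closed_supp_mu: "closed (supp_mu a)"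
proof -
  have "supp_mu a = (\<Inter>n. (\<lambda>g. g n) -` {0..a n})"
    by (auto simp: supp_mu_def)
  then show ?thesis
    by (simp add: closed_INT closed_vimage continuous_coordinate)
qed

lemma compact_of_closed_subset_supp_mu:
  "closed K \<Longrightarrow> K \<subseteq> supp_mu a \<Longrightarrow> compact K"
  using compact_supp_mu compact_Int_closed by (metis inf.absorb_iff2)

lemma sets_varrho: "sets (varrho k) = sets borel"
  by (simp add: varrho_def sets_borel_eq_count_space)

lemma sets_mu: "sets (mu a) = sets borel"
proof -
  have "sets (mu a) = sets (PiM UNIV (\<lambda>i::nat. borel :: int measure))"
    unfolding mu_def by (intro sets_PiM_cong) (auto simp: sets_varrho)
  then show ?thesis by (simp add: sets_PiM_equal_borel)
qed

lemma space_mu [simp]: "space (mu a) = UNIV"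
  using sets_eq_imp_space_eq[OF sets_mu] by simp

lemma prob_space_varrho: "prob_space (varrho k)"
  unfolding varrho_def by (rule prob_space_measure_pmf)

lemma prob_space_mu: "prob_space (mu a)"
  unfolding mu_def by (intro prob_space_PiM prob_space_varrho)

lemma borel_measurable_clop: "clop L \<in> sets (mu a)"
  unfolding sets_mu using open_clop by auto

lemma AE_supp_mu:
  assumes "a \<in> topspace Zpos_omega"
  shows "AE g in mu a. g \<in> supp_mu a"
proof -
  have "AE g in mu a. g n \<in> {0..a n}" for n
    unfolding mu_def
  proof (rule AE_PiM_component)
    \<comment> \<open>Positivity makes the interval nonempty, so that \<open>pmf_of_set\<close> is
      the uniform distribution on it.\<close>
    have "{0..a n} \<noteq> {}" using assms by (simp add: less_imp_le)
    then show "AE x in varrho (a n). x \<in> {0..a n}"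
      unfolding varrho_def AE_measure_pmf_iff by simp
  qed (auto intro: prob_space_varrho)
  then have "AE g in mu a. \<forall>n. g n \<in> {0..a n}" by (simp add: AE_all_countable)
  then show ?thesis by (simp add: supp_mu_def)
qed

text \<open>Membership in \<open>clop L\<close> reads only finitely many coordinates, so its measure
  is computed in the finite product over those, where only the values of \<open>a\<close> there
  enter.\<close>

lemma measure_clop_cong:
  assumes ab: "\<And>i l. l \<in> set L \<Longrightarrow> i < length l \<Longrightarrow> a i = b i"
  shows "measure (mu a) (clop L) = measure (mu b) (clop L)"
proof -
  define J where "J = (\<Union>l\<in>set L. {..<length l})"
  have J: "finite J" by (simp add: J_def)
  define F where "F = (\<Union>l\<in>set L. {x \<in> PiE J (\<lambda>_. UNIV :: int set). \<forall>i<length l. x i = l ! i})"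
  have eq: "measure (mu c) (clop L) = measure (PiM J (\<lambda>n. varrho (c n))) F" for c
  proof -
    interpret product_prob_space "\<lambda>n. varrho (c n)" UNIV
      by (intro product_prob_spaceI prob_space_varrho)
    have sp: "space (varrho k) = UNIV" for k
      by (simp add: varrho_def)
    have "F = (\<Union>l\<in>set L. {x \<in> space (PiM J (\<lambda>n. varrho (c n))). \<forall>i\<in>{..<length l}. x i = l ! i})"
      by (auto simp: F_def space_PiM sp)
    also have "\<dots> \<in> sets (PiM J (\<lambda>n. varrho (c n)))"
    proof (intro sets.finite_UN sets.sets_Collect_finite_All sets_Collect_single')
      show "i \<in> J" if "l \<in> set L" "i \<in> {..<length l}" for l i
        using that by (auto simp: J_def)
    qed (auto simp: varrho_def)
    finally have "emeasure (PiM UNIV (\<lambda>n. varrho (c n))) (prod_emb UNIV (\<lambda>n. varrho (c n)) J F) =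
        emeasure (PiM J (\<lambda>n. varrho (c n))) F"
      using J by (intro emeasure_PiM_emb') auto
    moreover have "restrict g J i = g i" if "l \<in> set L" "i < length l" for g :: "nat \<Rightarrow> int" and l i
      using that by (auto simp: J_def)
    then have "prod_emb UNIV (\<lambda>n. varrho (c n)) J F = clop L"
      unfolding prod_emb_def F_def clop_def cyl_def by (simp add: sp set_eq_iff cong: conj_cong)
    ultimately show ?thesis unfolding mu_def measure_def by simp
  qed
  have "PiM J (\<lambda>n. varrho (a n)) = PiM J (\<lambda>n. varrho (b n))"
    using ab by (intro PiM_cong) (auto simp: J_def)
  then show ?thesis unfolding eq by simp
qed

text \<open>The cylinder neighbourhoods \<open>U n\<close> of depth \<open>n\<close> decrease to the
  closed set \<open>K\<close>, so their measures converge to that of \<open>K\<close>; by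
  compactness a finite union of cylinders fits between \<open>K\<close> and a \<open>U n\<close> of
  measure below \<open>q\<close>.\<close>

lemma outer_regular_clop:
  assumes K: "closed K" "K \<subseteq> supp_mu a" and q: "measure (mu a) K < q"
  obtains L where "K \<subseteq> clop L" "measure (mu a) (clop L) < q"
proof -
  interpret prob_space "mu a" by (rule prob_space_mu)
  define U where "U n = (\<Union>h\<in>K. cyl (map h [0..<n]))" for n
  have op: "open (U n)" for n
    unfolding U_def using open_cyl by auto
  have KU: "K \<subseteq> U n" for n
    unfolding U_def by (auto simp: mem_cyl_restrict)
  have "decseq U"
    unfolding decseq_def U_def by (fastforce simp: mem_cyl_restrict)
  moreover have "range U \<subseteq> sets (mu a)"
    using op by (auto simp: sets_mu)
  ultimately have "(\<lambda>n. measure (mu a) (U n)) \<longlonglongrightarrow> measure (mu a) (\<Inter>n. U n)"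
    by (intro finite_Lim_measure_decseq)
  moreover have "(\<Inter>n. U n) = K"
  proof
    show "(\<Inter>n. U n) \<subseteq> K"
    proof (rule ccontr)
      assume "\<not> (\<Inter>n. U n) \<subseteq> K"
      then obtain g where g: "\<And>n. g \<in> U n" "g \<in> - K" by blast
      then obtain n where n: "cyl (map g [0..<n]) \<subseteq> - K"
        using open_contains_cyl[of "- K" g] K(1) by (auto simp: open_Compl)
      obtain h where "h \<in> K" "\<forall>i<n. g i = h i"
        using g(1)[of n] by (auto simp: U_def mem_cyl_restrict)
      then show False using n by (auto simp: mem_cyl_restrict subset_iff)
    qed
  qed (use KU in blast)
  ultimately have "(\<lambda>n. measure (mu a) (U n)) \<longlonglongrightarrow> measure (mu a) K" by simp
  then have "\<forall>\<^sub>F n in sequentially. measure (mu a) (U n) < q"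
    using q by (rule order_tendstoD(2))
  then obtain n where n: "measure (mu a) (U n) < q"
    by (auto dest: eventually_happens)
  obtain L where "K \<subseteq> clop L" "clop L \<subseteq> U n"
    using compact_subset_clop[OF compact_of_closed_subset_supp_mu[OF K] op KU] by blast
  moreover then have "measure (mu a) (clop L) \<le> measure (mu a) (U n)"
    using op by (intro finite_measure_mono) (auto simp: sets_mu)
  ultimately show thesis using n by (intro that) auto
qed

text \<open>A tube lemma in which the compact fibre moves with the parameter. Finitely many product
  neighbourhoods cover the fibre over \<open>p\<close>; their cylinders read only the first
  \<open>n\<close> coordinates, and parameters agreeing with \<open>fst p\<close> there have the
  same fibre up to depth \<open>n\<close>.\<close>

lemma openin_supp_mu_tube:
  assumes W: "openin (prod_topology (prod_topology Zpos_omega Cantor) Z_omega) W"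
  shows "openin (prod_topology Zpos_omega Cantor)
    {p \<in> topspace (prod_topology Zpos_omega Cantor). \<forall>g\<in>supp_mu (fst p). (p, g) \<in> W}"
    (is "openin ?X ?T")
proof (subst openin_subopen, rule ballI)
  fix p assume p: "p \<in> ?T"
  have "\<exists>O' l. openin ?X O' \<and> p \<in> O' \<and> g \<in> cyl l \<and> O' \<times> cyl l \<subseteq> W" if "g \<in> supp_mu (fst p)" for g
  proof -
    have "(p, g) \<in> W" using that p by auto
    moreover have "\<forall>x y. (x, y) \<in> W \<longrightarrow>
        (\<exists>O' V. openin ?X O' \<and> openin Z_omega V \<and> x \<in> O' \<and> y \<in> V \<and> O' \<times> V \<subseteq> W)"
      using W unfolding openin_prod_topology_alt[of ?X] .
    ultimately obtain O' V where "openin ?X O'" "openin Z_omega V" "p \<in> O'" "g \<in> V" "O' \<times> V \<subseteq> W"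
      by metis
    moreover then have "open V" by (simp add: Z_omega_eq)
    moreover obtain n where "cyl (map g [0..<n]) \<subseteq> V"
      using open_contains_cyl[OF \<open>open V\<close> \<open>g \<in> V\<close>] by blast
    ultimately show ?thesis
      by (intro exI[of _ O'] exI[of _ "map g [0..<n]"]) (auto simp: mem_cyl_restrict)
  qed
  then obtain N l where N: "\<And>g. g \<in> supp_mu (fst p) \<Longrightarrow> openin ?X (N g)"
    "\<And>g. g \<in> supp_mu (fst p) \<Longrightarrow> p \<in> N g"
    "\<And>g. g \<in> supp_mu (fst p) \<Longrightarrow> g \<in> cyl (l g)"
    "\<And>g. g \<in> supp_mu (fst p) \<Longrightarrow> N g \<times> cyl (l g) \<subseteq> W"
    by metis
  obtain C where C: "C \<subseteq> supp_mu (fst p)" "finite C" "supp_mu (fst p) \<subseteq> (\<Union>g\<in>C. cyl (l g))"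
    by (rule compactE_image[OF compact_supp_mu[of "fst p"], of "supp_mu (fst p)" "\<lambda>g. cyl (l g)"])
      (use N(3) in \<open>auto intro: open_cyl\<close>)
  obtain n where n: "\<And>g. g \<in> C \<Longrightarrow> length (l g) \<le> n"
    using C(2) by (metis finite_imageI finite_nat_set_iff_bounded_le imageI)
  define E where "E = {b \<in> topspace Zpos_omega. \<forall>i<n. b i = fst p i}"
  have E: "openin Zpos_omega E"
    unfolding E_def by (rule openin_Zpos_omega_initial_segment[of n]) auto
  have pX: "fst p \<in> topspace Zpos_omega" using p by auto
  define T where "T = (E \<times> topspace Cantor) \<inter> (topspace ?X \<inter> (\<Inter>g\<in>C. N g))"
  have "openin ?X (topspace ?X \<inter> (\<Inter>g\<in>C. N g))"
    using C N(1) by (cases "C = {}") (auto intro!: openin_Int openin_INT2 simp del: topspace_prod_topology)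
  moreover have "openin ?X (E \<times> topspace Cantor)"
    unfolding openin_prod_Times_iff using E openin_topspace by blast
  ultimately have "openin ?X T"
    unfolding T_def by (metis openin_Int)
  moreover have "p \<in> T"
    using p pX C N(2) by (auto simp: T_def E_def mem_Times_iff)
  moreover have "T \<subseteq> ?T"
  proof
    fix p' assume p': "p' \<in> T"
    have "(p', g) \<in> W" if g: "g \<in> supp_mu (fst p')" for g
    proof -
      \<comment> \<open>Setting the tail to 0 brings the point into the fibre over \<open>p\<close>,
        and cylinders of length at most \<open>n\<close> cannot see the change.\<close>
      define g' where "g' i = (if i < n then g i else 0)" for i
      have "g' \<in> supp_mu (fst p)"
      proof -
        have "0 \<le> g' i \<and> g' i \<le> fst p i" for i
        proof -
          have "0 \<le> fst p i" "i < n \<Longrightarrow> fst p' i = fst p i" "0 \<le> g i" "g i \<le> fst p' i"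
            using g p' pX unfolding supp_mu_def T_def E_def by (auto simp: less_imp_le)
          then show ?thesis by (cases "i < n") (simp_all add: g'_def)
        qed
        then show ?thesis by (simp add: supp_mu_def)
      qed
      then obtain h where h: "h \<in> C" "g' \<in> cyl (l h)" using C(3) by blast
      then have "g \<in> cyl (l h)"
        using n[OF h(1)] by (auto simp: cyl_def g'_def)
      moreover have "p' \<in> N h" using p' h(1) by (auto simp: T_def)
      ultimately show ?thesis using N(4)[of h] h(1) C(1) by blast
    qed
    moreover have "p' \<in> topspace ?X" using p' by (auto simp: T_def)
    ultimately show "p' \<in> ?T" by blast
  qed
  ultimately show "\<exists>T. openin ?X T \<and> p \<in> T \<and> T \<subseteq> ?T" by blast
qed

section \<open>Measurable compact-valued maps\<close>

definition params :: "((nat \<Rightarrow> int) \<times> (nat \<Rightarrow> bool)) topology" where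
  "params = prod_topology Zpos_omega Cantor"

lemma metrizable_space_params: "metrizable_space params"
  unfolding params_def metrizable_space_prod_topology
  using metrizable_space_Zpos_omega metrizable_space_Cantor by simp

lemma metrizable_space_Z_omega: "metrizable_space Z_omega"
  unfolding Z_omega_def metrizable_space_product_topology by auto

lemma metrizable_space_params_Z_omega: "metrizable_space (prod_topology params Z_omega)"
  unfolding metrizable_space_prod_topology
  using metrizable_space_params metrizable_space_Z_omega by simp

lemma topspace_Z_omega [simp]: "topspace Z_omega = UNIV"
  by (simp add: Z_omega_eq)

lemma fst_params: "p \<in> topspace params \<Longrightarrow> fst p \<in> topspace Zpos_omega"
  unfolding params_def topspace_prod_topology by (simp only: mem_Times_iff)

text \<open>Upper semicontinuity of a compact-valued map, with \<open>\<Sigma>\<^sub>r\<close> sets in place of open sets.\<close>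

definition usc :: "nat rel \<Rightarrow> ((nat \<Rightarrow> int) \<times> (nat \<Rightarrow> bool) \<Rightarrow> (nat \<Rightarrow> int) set) \<Rightarrow> bool" where
  "usc r K \<longleftrightarrow> (\<forall>p\<in>topspace params. closed (K p) \<and> K p \<subseteq> supp_mu (fst p)) \<and>
    (\<forall>U. open U \<longrightarrow> borel_sigma params r {p \<in> topspace params. K p \<subseteq> U})"

lemma usc_Field: "usc r K \<Longrightarrow> Field r \<noteq> {}"
  unfolding usc_def using borel_sigma_Field open_UNIV by blast

lemma usc_mono: "usc r K \<Longrightarrow> r <o r' \<Longrightarrow> usc r' K"
  unfolding usc_def using borel_sigma_mono_less by blast

lemma usc_compact: "usc r K \<Longrightarrow> p \<in> topspace params \<Longrightarrow> compact (K p)"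
  unfolding usc_def by (intro compact_of_closed_subset_supp_mu[of _ "fst p"]) auto

section \<open>Closure properties of \<open>usc\<close>\<close>

lemma usc_UN:
  fixes M :: nat
  assumes K: "\<And>m. m \<le> M \<Longrightarrow> usc r (K m)"
  shows "usc r (\<lambda>p. \<Union>m\<le>M. K m p)"
  unfolding usc_def
proof (intro conjI ballI allI impI)
  fix p assume "p \<in> topspace params"
  then show "closed (\<Union>m\<le>M. K m p)" "(\<Union>m\<le>M. K m p) \<subseteq> supp_mu (fst p)"
    using K unfolding usc_def by (auto intro!: closed_UN)
next
  fix U :: "(nat \<Rightarrow> int) set" assume U: "open U"
  have "borel_sigma params r (topspace params \<inter> (\<Inter>m\<in>{..M}. {p \<in> topspace params. K m p \<subseteq> U}))"
    using K U unfolding usc_def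
    by (intro borel_sigma_INT metrizable_space_params usc_Field[OF K[of 0]]) auto
  also have "topspace params \<inter> (\<Inter>m\<in>{..M}. {p \<in> topspace params. K m p \<subseteq> U}) =
      {p \<in> topspace params. (\<Union>m\<le>M. K m p) \<subseteq> U}"
    by auto
  finally show "borel_sigma params r {p \<in> topspace params. (\<Union>m\<le>M. K m p) \<subseteq> U}" .
qed

text \<open>A compact \<open>K\<^sub>1\<close> with \<open>K\<^sub>1 \<inter> K\<^sub>2 \<subseteq> U\<close> has a neighbourhood \<open>V\<close> from the countable clopen base
  with \<open>K\<^sub>2 \<subseteq> U \<union> - V\<close>.\<close>

lemma usc_Int:
  assumes K1: "usc r K1" and K2: "usc r K2"
  shows "usc r (\<lambda>p. K1 p \<inter> K2 p)"
  unfolding usc_def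
proof (intro conjI ballI allI impI)
  fix p assume "p \<in> topspace params"
  then show "closed (K1 p \<inter> K2 p)" "K1 p \<inter> K2 p \<subseteq> supp_mu (fst p)"
    using K1 K2 unfolding usc_def by auto
next
  fix U :: "(nat \<Rightarrow> int) set" assume U: "open U"
  let ?S = "\<lambda>L. {p \<in> topspace params. K1 p \<subseteq> clop L} \<inter> {p \<in> topspace params. K2 p \<subseteq> U \<union> - clop L}"
  have "borel_sigma params r (\<Union>L\<in>UNIV. ?S L)"
  proof (intro borel_sigma_UN borel_sigma_Int metrizable_space_params usc_Field[OF K1] countableI_type)
    show "borel_sigma params r {p \<in> topspace params. K1 p \<subseteq> clop L}" for L
      using K1 open_clop unfolding usc_def by blast
    show "borel_sigma params r {p \<in> topspace params. K2 p \<subseteq> U \<union> - clop L}" for L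
      using K2 U closed_clop unfolding usc_def by (auto simp: open_Un open_Compl)
  qed
  also have "(\<Union>L\<in>UNIV. ?S L) = {p \<in> topspace params. K1 p \<inter> K2 p \<subseteq> U}"
  proof
    show "{p \<in> topspace params. K1 p \<inter> K2 p \<subseteq> U} \<subseteq> (\<Union>L\<in>UNIV. ?S L)"
    proof
      fix p assume p: "p \<in> {p \<in> topspace params. K1 p \<inter> K2 p \<subseteq> U}"
      then have "open (U \<union> - K2 p)"
        using U K2 unfolding usc_def by (auto simp: open_Compl)
      then obtain L where "K1 p \<subseteq> clop L" "clop L \<subseteq> U \<union> - K2 p"
        using compact_subset_clop[OF usc_compact[OF K1], of p "U \<union> - K2 p"] p by blast
      then show "p \<in> (\<Union>L\<in>UNIV. ?S L)" using p by blast
    qed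
  qed blast
  finally show "borel_sigma params r {p \<in> topspace params. K1 p \<inter> K2 p \<subseteq> U}" .
qed

text \<open>By compactness of \<open>K 0 p\<close>, the full intersection lies in \<open>U\<close>
  iff some finite one does, so the condition is a countable union of conditions on finite
  intersections, which \<open>usc_Int\<close> handles.\<close>

lemma usc_INT:
  fixes K :: "nat \<Rightarrow> _"
  assumes K: "\<And>m. usc r (K m)"
  shows "usc r (\<lambda>p. \<Inter>m. K m p)"
proof -
  have fin: "usc r (\<lambda>p. \<Inter>m\<le>M. K m p)" for M
  proof (induction M)
    case (Suc M)
    have "(\<lambda>p. \<Inter>m\<le>Suc M. K m p) = (\<lambda>p. K (Suc M) p \<inter> (\<Inter>m\<le>M. K m p))"
      by (simp add: atMost_Suc)
    then show ?case using usc_Int[OF K Suc] by simp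
  qed (simp add: K)
  show ?thesis
    unfolding usc_def
  proof (intro conjI ballI allI impI)
    fix p assume "p \<in> topspace params"
    then have *: "closed (K m p)" "K m p \<subseteq> supp_mu (fst p)" for m
      using K unfolding usc_def by auto
    show "closed (\<Inter>m. K m p)" using *(1) by (intro closed_INT) auto
    show "(\<Inter>m. K m p) \<subseteq> supp_mu (fst p)" using *(2)[of 0] by auto
  next
    fix U :: "(nat \<Rightarrow> int) set" assume U: "open U"
    have "borel_sigma params r (\<Union>M. {p \<in> topspace params. (\<Inter>m\<le>M. K m p) \<subseteq> U})"
      using fin U unfolding usc_def by (intro borel_sigma_UN_nat metrizable_space_params) blast
    also have "(\<Union>M. {p \<in> topspace params. (\<Inter>m\<le>M. K m p) \<subseteq> U}) = {p \<in> topspace params. (\<Inter>m. K m p) \<subseteq> U}"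
    proof
      show "{p \<in> topspace params. (\<Inter>m. K m p) \<subseteq> U} \<subseteq> (\<Union>M. {p \<in> topspace params. (\<Inter>m\<le>M. K m p) \<subseteq> U})"
      proof
        fix p assume p: "p \<in> {p \<in> topspace params. (\<Inter>m. K m p) \<subseteq> U}"
        define V where "V m = U \<union> - K m p" for m
        have "compact (K 0 p)" using usc_compact[OF K] p by blast
        moreover have "open (V m)" if "m \<in> UNIV" for m
          using K p U unfolding usc_def V_def by (intro open_Un open_Compl) auto
        moreover have "K 0 p \<subseteq> (\<Union>m\<in>UNIV. V m)" using p by (auto simp: V_def)
        ultimately obtain C where C: "finite C" "K 0 p \<subseteq> (\<Union>m\<in>C. V m)"
          by (rule compactE_image)
        obtain M where "C \<subseteq> {..M}" using C(1) finite_nat_iff_bounded_le by auto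
        have "(\<Inter>m\<le>M. K m p) \<subseteq> U"
        proof
          fix g assume g: "g \<in> (\<Inter>m\<le>M. K m p)"
          then obtain m where "m \<in> C" "g \<in> V m" using C(2) by blast
          then show "g \<in> U" using g \<open>C \<subseteq> {..M}\<close> by (auto simp: V_def)
        qed
        then show "p \<in> (\<Union>M. {p \<in> topspace params. (\<Inter>m\<le>M. K m p) \<subseteq> U})"
          using p by blast
      qed
    qed auto
    finally show "borel_sigma params r {p \<in> topspace params. (\<Inter>m. K m p) \<subseteq> U}" .
  qed
qed

text \<open>On each level set of the selector the map is one of the \<open>K k\<close>, so the
  condition splits into countably many \<open>\<Sigma>\<^sub>r\<close> pieces.\<close>

lemma usc_piecewise:
  fixes \<kappa> :: "_ \<Rightarrow> nat"
  assumes \<kappa>: "\<And>k. borel_sigma params r {p \<in> topspace params. \<kappa> p = k}" and K: "\<And>k. usc r (K k)"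
  shows "usc r (\<lambda>p. K (\<kappa> p) p)"
  unfolding usc_def
proof (intro conjI ballI allI impI)
  fix p assume "p \<in> topspace params"
  then show "closed (K (\<kappa> p) p)" "K (\<kappa> p) p \<subseteq> supp_mu (fst p)"
    using K unfolding usc_def by auto
next
  fix U :: "(nat \<Rightarrow> int) set" assume U: "open U"
  have "borel_sigma params r (\<Union>k. {p \<in> topspace params. \<kappa> p = k} \<inter> {p \<in> topspace params. K k p \<subseteq> U})"
    using \<kappa> K U unfolding usc_def
    by (intro borel_sigma_UN_nat borel_sigma_Int metrizable_space_params) auto
  also have "(\<Union>k. {p \<in> topspace params. \<kappa> p = k} \<inter> {p \<in> topspace params. K k p \<subseteq> U}) =
      {p \<in> topspace params. K (\<kappa> p) p \<subseteq> U}"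
    by auto
  finally show "borel_sigma params r {p \<in> topspace params. K (\<kappa> p) p \<subseteq> U}" .
qed

section \<open>Measure thresholds and selection of indices\<close>

lemma borel_sigma_initial_segment:
  assumes "\<And>a b. (\<forall>i<n. a i = b i) \<Longrightarrow> P a \<Longrightarrow> P b" and r: "Field r \<noteq> {}"
  shows "borel_sigma params r {p \<in> topspace params. P (fst p)}"
proof -
  have "borel_sigma Zpos_omega r {a \<in> topspace Zpos_omega. P a}"
    using openin_Zpos_omega_initial_segment[of n P] assms by (intro borel_sigma.sigma_open) auto
  from borel_sigma_vimage[OF continuous_map_fst this]
  have "borel_sigma params r {p \<in> topspace params. fst p \<in> {a \<in> topspace Zpos_omega. P a}}"
    unfolding params_def .
  also have "{p \<in> topspace params. fst p \<in> {a \<in> topspace Zpos_omega. P a}} = {p \<in> topspace params. P (fst p)}"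
    using fst_params by blast
  finally show ?thesis .
qed

lemma borel_sigma_measure_clop_less:
  assumes "Field r \<noteq> {}"
  shows "borel_sigma params r {p \<in> topspace params. measure (mu (fst p)) (clop L) < q}"
proof (rule borel_sigma_initial_segment[OF _ assms])
  fix a b :: "nat \<Rightarrow> int"
  \<comment> \<open>The bound is the length of the longest list in \<open>L\<close>; 0 is inserted
    for the case of an empty \<open>L\<close>.\<close>
  assume ab: "\<forall>i<Max (insert 0 (length ` set L)). a i = b i" and a: "measure (mu a) (clop L) < q"
  have "a i = b i" if "l \<in> set L" "i < length l" for i l
  proof -
    have "length l \<le> Max (insert 0 (length ` set L))"
      using that(1) by (intro Max_ge) auto
    then show ?thesis using ab that(2) by auto
  qed
  then have "measure (mu a) (clop L) = measure (mu b) (clop L)" by (rule measure_clop_cong)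
  with a show "measure (mu b) (clop L) < q" by simp
qed

lemma usc_measurable:
  assumes "usc r K" "p \<in> topspace params"
  shows "K p \<in> sets (mu a)"
  using assms unfolding usc_def sets_mu by (simp add: borel_closed)

text \<open>By outer regularity, \<open>K p\<close> has measure below \<open>q\<close> iff some
  \<open>clop L\<close> containing it does. There are countably many \<open>L\<close>, and the
  measure of \<open>clop L\<close> is locally constant in the parameter.\<close>

lemma usc_measure_less:
  assumes K: "usc r K"
  shows "borel_sigma params r {p \<in> topspace params. measure (mu (fst p)) (K p) < q}"
proof -
  let ?S = "\<lambda>L. {p \<in> topspace params. K p \<subseteq> clop L} \<inter>
    {p \<in> topspace params. measure (mu (fst p)) (clop L) < q}"
  have "borel_sigma params r (\<Union>L\<in>UNIV. ?S L)"
    using K open_clop unfolding usc_def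
    by (intro borel_sigma_UN borel_sigma_Int metrizable_space_params usc_Field[OF K] countableI_type
        borel_sigma_measure_clop_less) blast
  also have "(\<Union>L\<in>UNIV. ?S L) = {p \<in> topspace params. measure (mu (fst p)) (K p) < q}"
  proof (intro equalityI subsetI)
    fix p assume "p \<in> (\<Union>L\<in>UNIV. ?S L)"
    then obtain L where L: "p \<in> topspace params" "K p \<subseteq> clop L" "measure (mu (fst p)) (clop L) < q"
      by blast
    interpret prob_space "mu (fst p)" by (rule prob_space_mu)
    have "measure (mu (fst p)) (K p) \<le> measure (mu (fst p)) (clop L)"
      using L(2) borel_measurable_clop by (rule finite_measure_mono)
    with L show "p \<in> {p \<in> topspace params. measure (mu (fst p)) (K p) < q}" by auto
  next
    fix p assume p: "p \<in> {p \<in> topspace params. measure (mu (fst p)) (K p) < q}"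
    then have "closed (K p)" "K p \<subseteq> supp_mu (fst p)"
      using K unfolding usc_def by auto
    then obtain L where "K p \<subseteq> clop L" "measure (mu (fst p)) (clop L) < q"
      using outer_regular_clop[of "K p" "fst p" q] p by blast
    then show "p \<in> (\<Union>L\<in>UNIV. ?S L)" using p by blast
  qed
  finally show ?thesis .
qed

text \<open>A strict lower bound is a countable union of non-strict ones, and these are complements
  of the given sets; this accounts for the passage from \<open>r\<close> to the larger
  \<open>r'\<close>.\<close>

lemma borel_sigma_strict_of_less:
  fixes h :: "_ \<Rightarrow> real"
  assumes h: "\<And>q. borel_sigma params r {p \<in> topspace params. h p < q}" and r: "r <o r'"
  shows "borel_sigma params r' {p \<in> topspace params. h p > q}"
proof -
  have "borel_sigma params r' (\<Union>n::nat. topspace params - {p \<in> topspace params. h p < q + 1 / real (Suc n)})"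
    by (intro borel_sigma_UN_nat metrizable_space_params borel_sigma_compl[OF h r])
  also have "(\<Union>n::nat. topspace params - {p \<in> topspace params. h p < q + 1 / real (Suc n)}) =
      {p \<in> topspace params. h p > q}"
  proof (intro equalityI subsetI)
    fix p assume "p \<in> (\<Union>n::nat. topspace params - {p \<in> topspace params. h p < q + 1 / real (Suc n)})"
    then obtain n where "p \<in> topspace params" "h p \<ge> q + 1 / real (Suc n)" by (auto simp: not_less)
    moreover have "0 < 1 / real (Suc n)" by simp
    ultimately have "p \<in> topspace params" "q < h p" by linarith+
    then show "p \<in> {p \<in> topspace params. h p > q}" by simp
  next
    fix p assume p: "p \<in> {p \<in> topspace params. h p > q}"
    then obtain n where "1 / real (Suc n) < h p - q"
      using reals_Archimedean[of "h p - q"] by (auto simp: inverse_eq_divide)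
    then show "p \<in> (\<Union>n::nat. topspace params - {p \<in> topspace params. h p < q + 1 / real (Suc n)})"
      using p by (auto intro!: exI[of _ n])
  qed
  finally show ?thesis .
qed

text \<open>Only finitely many earlier sets are removed, and their complements lie in the class as
  well.\<close>

lemma borel_sigma_first_index:
  assumes X: "metrizable_space X"
    and E: "\<And>j::nat. borel_sigma X r (E j)" "\<And>j. borel_sigma X r (topspace X - E j)"
  shows "borel_sigma X r {x \<in> E j. \<forall>i<j. x \<notin> E i}"
proof -
  have "borel_sigma X r (E j \<inter> (topspace X \<inter> (\<Inter>i\<in>{..<j}. topspace X - E i)))"
    by (intro borel_sigma_Int borel_sigma_INT X E borel_sigma_Field[OF E(1)]) auto
  also have "E j \<inter> (topspace X \<inter> (\<Inter>i\<in>{..<j}. topspace X - E i)) = {x \<in> E j. \<forall>i<j. x \<notin> E i}"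
    using borel_sigma_subset[OF E(1)[of j]] by auto
  finally show ?thesis .
qed

text \<open>The first level is excluded because there the statement needs \<open>X\<close> to be zero-dimensional.\<close>

lemma borel_sigma_reduction:
  fixes r r1 :: "nat rel"
  assumes X: "metrizable_space X" and r1: "r1 <o r" "Field r1 \<noteq> {}"
    and T: "\<And>k::nat. borel_sigma X r (T k)" and cover: "topspace X \<subseteq> (\<Union>k. T k)"
  obtains \<kappa> where "\<And>k. borel_sigma X r {x \<in> topspace X. \<kappa> x = k}"
    "\<And>x. x \<in> topspace X \<Longrightarrow> x \<in> T (\<kappa> x)"
proof -
  have "\<exists>A. T k = (\<Union>n::nat. A n) \<and> (\<forall>n. A n \<subseteq> topspace X \<and>
    (\<exists>r' :: nat rel. r' <o r \<and> borel_sigma X r' (topspace X - A n)))" for k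
    using borel_sigma_limit_rep[OF X r1 T[of k]] by metis
  then obtain A where A: "\<And>k. T k = (\<Union>n::nat. A k n)"
    "\<And>k n. A k n \<subseteq> topspace X"
    "\<And>k n. \<exists>r' :: nat rel. r' <o r \<and> borel_sigma X r' (topspace X - A k n)"
    by metis
  \<comment> \<open>The pieces of \<open>T k\<close> belong to the class together with their
    complements, so they can be made disjoint within it.\<close>
  have A\<Delta>: "borel_sigma X r (A k n)" "borel_sigma X r (topspace X - A k n)" for k n
  proof -
    obtain r' :: "nat rel" where r': "r' <o r" "borel_sigma X r' (topspace X - A k n)"
      using A(3) by blast
    show "borel_sigma X r (topspace X - A k n)" using borel_sigma_mono_less r' by blast
    have "topspace X - (topspace X - A k n) = A k n" using A(2)[of k n] by auto
    then show "borel_sigma X r (A k n)" using borel_sigma_compl[OF r'(2,1)] by simp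
  qed
  \<comment> \<open>All pieces of all \<open>T k\<close> are listed in one sequence; the first piece
    containing \<open>x\<close> determines the index \<open>k\<close> that it came from.\<close>
  define E where "E j = A (fst (prod_decode j)) (snd (prod_decode j))" for j
  define first where "first x = (LEAST j. x \<in> E j)" for x
  have first: "x \<in> E (first x)" "\<And>i. i < first x \<Longrightarrow> x \<notin> E i" if x: "x \<in> topspace X" for x
  proof -
    obtain k n where "x \<in> A k n" using cover x A(1) by blast
    then have "x \<in> E (prod_encode (k, n))" by (simp add: E_def)
    then show "x \<in> E (first x)" unfolding first_def by (rule LeastI)
    show "\<And>i. i < first x \<Longrightarrow> x \<notin> E i" unfolding first_def by (rule not_less_Least)
  qed
  have first_eq: "{x \<in> E j. \<forall>i<j. x \<notin> E i} = {x \<in> topspace X. first x = j}" for j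
  proof -
    have "E j \<subseteq> topspace X" using A(2) by (simp add: E_def)
    moreover have "first x = j" if "x \<in> E j" "\<forall>i<j. x \<notin> E i" for x
      unfolding first_def using that by (intro Least_equality) (auto simp: not_less[symmetric])
    ultimately show ?thesis using first by blast
  qed
  define \<kappa> where "\<kappa> x = fst (prod_decode (first x))" for x
  show thesis
  proof (rule that)
    show "borel_sigma X r {x \<in> topspace X. \<kappa> x = k}" for k
    proof -
      have "borel_sigma X r (\<Union>j\<in>{j. fst (prod_decode j) = k}. {x \<in> E j. \<forall>i<j. x \<notin> E i})"
        by (intro borel_sigma_UN X borel_sigma_first_index borel_sigma_Field[OF T])
          (simp_all add: E_def A\<Delta>)
      also have "(\<Union>j\<in>{j. fst (prod_decode j) = k}. {x \<in> E j. \<forall>i<j. x \<notin> E i}) =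
          {x \<in> topspace X. \<kappa> x = k}"
        unfolding first_eq \<kappa>_def by auto
      finally show ?thesis .
    qed
    show "x \<in> T (\<kappa> x)" if "x \<in> topspace X" for x
      using first(1)[OF that] unfolding A(1) \<kappa>_def E_def by blast
  qed
qed

section \<open>Approximation from inside\<close>

definition sec :: "('a \<times> 'b) set \<Rightarrow> 'a \<Rightarrow> 'b set" where
  "sec S p = {g. (p, g) \<in> S}"

lemma borel_sigma_imp_borel: "borel_sigma Z_omega r S \<Longrightarrow> S \<in> sets borel"
proof (induction rule: borel_sigma.induct)
  case (sigma_open r S)
  then show ?case by (simp add: Z_omega_eq flip: open_openin)
next
  case (sigma_union A r)
  have "A n \<in> sets borel" for n
  proof -
    have "topspace Z_omega - A n \<in> sets borel" using sigma_union by blast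
    then have "- (UNIV - A n) \<in> sets borel" by (intro borel_comp) simp
    then show ?thesis by (simp add: Compl_eq_Diff_UNIV double_diff)
  qed
  then show ?case by blast
qed

lemma continuous_map_Pair: "p \<in> topspace X \<Longrightarrow> continuous_map Y (prod_topology X Y) (Pair p)"
  by (simp add: continuous_map_pairwise comp_def)

lemma sec_measurable:
  assumes "borel_sigma (prod_topology X Z_omega) r S" "p \<in> topspace X"
  shows "sec S p \<in> sets (mu a)"
proof -
  have "borel_sigma Z_omega r {g \<in> topspace Z_omega. (p, g) \<in> S}"
    using assms by (intro borel_sigma_vimage[OF continuous_map_Pair])
  then show ?thesis
    unfolding sets_mu sec_def by (intro borel_sigma_imp_borel) simp
qed

lemma sec_compl_measurable:
  assumes "borel_sigma (prod_topology X Z_omega) r (topspace (prod_topology X Z_omega) - A)"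
    "A \<subseteq> topspace (prod_topology X Z_omega)" "p \<in> topspace X"
  shows "sec A p \<in> sets (mu a)"
proof -
  have "sec A p = UNIV - sec (topspace (prod_topology X Z_omega) - A) p"
    using assms(2,3) by (auto simp: sec_def)
  then show ?thesis using sec_measurable[OF assms(1,3)] by (metis sets.compl_sets space_mu)
qed

definition ambient :: "(((nat \<Rightarrow> int) \<times> (nat \<Rightarrow> bool)) \<times> (nat \<Rightarrow> int)) topology" where
  "ambient = prod_topology params Z_omega"

lemma topspace_ambient: "topspace ambient = topspace params \<times> UNIV"
  by (simp add: ambient_def)

text \<open>One map meets the error bound for all parameters at once. This is the form obtained for
  complements of \<open>\<Sigma>\<^sub>r\<close> sets.\<close>

definition uniform_inner :: "nat rel \<Rightarrow> (((nat \<Rightarrow> int) \<times> (nat \<Rightarrow> bool)) \<times> (nat \<Rightarrow> int)) set \<Rightarrow> bool" where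
  "uniform_inner r A \<longleftrightarrow> (\<forall>\<epsilon>>0. \<exists>K. usc r K \<and> (\<forall>p\<in>topspace params. K p \<subseteq> sec A p \<and>
     measure (mu (fst p)) (sec A p) - \<epsilon> \<le> measure (mu (fst p)) (K p)))"

text \<open>The form obtained for \<open>\<Sigma>\<^sub>r\<close> sets: the index attaining a given
  error may depend on the parameter. Selecting it measurably happens at a higher class, in
  \<open>uniform_inner_INT\<close>.\<close>

definition pointwise_inner :: "nat rel \<Rightarrow> (((nat \<Rightarrow> int) \<times> (nat \<Rightarrow> bool)) \<times> (nat \<Rightarrow> int)) set \<Rightarrow> bool" where
  "pointwise_inner r S \<longleftrightarrow> (\<exists>K :: nat \<Rightarrow> _. (\<forall>k. usc r (K k)) \<and>
     (\<forall>p\<in>topspace params. (\<forall>k. K k p \<subseteq> sec S p) \<and>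
       (\<forall>\<delta>>0. \<exists>k. measure (mu (fst p)) (sec S p) - \<delta> < measure (mu (fst p)) (K k p))))"

lemma uniform_inner_mono: "uniform_inner r A \<Longrightarrow> r <o r' \<Longrightarrow> uniform_inner r' A"
  unfolding uniform_inner_def using usc_mono by meson

text \<open>Cutting the closed section down to the compact support loses no measure, so one
  \<open>K\<close> serves every \<epsilon>. Its semicontinuity is the tube lemma applied to the
  complement of \<open>A\<close> together with \<open>topspace params \<times> U\<close>.\<close>

lemma uniform_inner_closedin:
  assumes A: "closedin ambient A" and r: "Field r \<noteq> {}"
  shows "uniform_inner r A"
proof -
  define K where "K p = sec A p \<inter> supp_mu (fst p)" for p
  have op: "openin ambient (topspace ambient - A)" using A by blast
  have cl: "closed (sec A p)" if p: "p \<in> topspace params" for p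
  proof -
    have "closedin Z_omega {g \<in> topspace Z_omega. (p, g) \<in> A}"
      using A unfolding ambient_def
      by (rule closedin_continuous_map_preimage[OF continuous_map_Pair[OF p]])
    then show ?thesis by (simp add: sec_def Z_omega_eq)
  qed
  have "usc r K"
    unfolding usc_def
  proof (intro conjI ballI allI impI)
    fix p assume "p \<in> topspace params"
    then show "closed (K p)"
      unfolding K_def by (intro closed_Int cl closed_supp_mu)
    show "K p \<subseteq> supp_mu (fst p)" by (simp add: K_def)
  next
    fix U :: "(nat \<Rightarrow> int) set" assume "open U"
    then have "openin ambient ((topspace ambient - A) \<union> topspace params \<times> U)"
      using op unfolding ambient_def
      by (intro openin_Un) (auto simp: openin_prod_Times_iff Z_omega_eq)
    then have "openin params {p \<in> topspace params. \<forall>g\<in>supp_mu (fst p).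
        (p, g) \<in> (topspace ambient - A) \<union> topspace params \<times> U}"
      unfolding ambient_def params_def by (rule openin_supp_mu_tube)
    also have "{p \<in> topspace params. \<forall>g\<in>supp_mu (fst p).
        (p, g) \<in> (topspace ambient - A) \<union> topspace params \<times> U} = {p \<in> topspace params. K p \<subseteq> U}"
      unfolding K_def sec_def topspace_ambient by blast
    finally show "borel_sigma params r {p \<in> topspace params. K p \<subseteq> U}"
      using r by (intro borel_sigma.sigma_open)
  qed
  moreover have "K p \<subseteq> sec A p" "measure (mu (fst p)) (sec A p) = measure (mu (fst p)) (K p)"
    if p: "p \<in> topspace params" for p
  proof -
    show "K p \<subseteq> sec A p" by (simp add: K_def)
    have "AE g in mu (fst p). g \<in> sec A p \<longleftrightarrow> g \<in> K p"
      using AE_supp_mu[OF fst_params[OF p]] by eventually_elim (simp add: K_def)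
    then show "measure (mu (fst p)) (sec A p) = measure (mu (fst p)) (K p)"
      using cl[OF p] usc_measurable[OF \<open>usc r K\<close> p]
      by (intro measure_eq_AE) (auto simp: sets_mu)
  qed
  ultimately show ?thesis
    unfolding uniform_inner_def by (intro allI impI exI[of _ K]) auto
qed

text \<open>Finite unions of approximations to the \<open>A n\<close> exhaust the union from inside;
  the parameter decides how many sets and which precision are needed.\<close>

lemma pointwise_inner_UN:
  fixes A :: "nat \<Rightarrow> _"
  assumes A: "\<And>n. uniform_inner r (A n)"
    and meas: "\<And>n p. p \<in> topspace params \<Longrightarrow> sec (A n) p \<in> sets (mu (fst p))"
  shows "pointwise_inner r (\<Union>n. A n)"
proof -
  have "\<exists>K. usc r K \<and> (\<forall>p\<in>topspace params. K p \<subseteq> sec (A n) p \<and>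
     measure (mu (fst p)) (sec (A n) p) - 1 / real (Suc j) \<le> measure (mu (fst p)) (K p))" for n j
    using A[of n] unfolding uniform_inner_def by (metis of_nat_0_less_iff zero_less_Suc zero_less_divide_1_iff)
  then obtain K where K: "\<And>n j. usc r (K n j)"
    "\<And>n j p. p \<in> topspace params \<Longrightarrow> K n j p \<subseteq> sec (A n) p"
    "\<And>n j p. p \<in> topspace params \<Longrightarrow>
      measure (mu (fst p)) (sec (A n) p) - 1 / real (Suc j) \<le> measure (mu (fst p)) (K n j p)"
    by metis
  define L where "L M j p = (\<Union>n\<le>M. K n j p)" for M j :: nat and p
  have L: "usc r (L M j)" for M j
    unfolding L_def using K(1) by (rule usc_UN)
  have sub: "L M j p \<subseteq> sec (\<Union>n. A n) p" if "p \<in> topspace params" for M j p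
    using K(2)[OF that] by (fastforce simp: L_def sec_def)
  have lim: "\<exists>M j. measure (mu (fst p)) (sec (\<Union>n. A n) p) - \<delta> < measure (mu (fst p)) (L M j p)"
    if p: "p \<in> topspace params" and \<delta>: "\<delta> > 0" for p \<delta>
  proof -
    interpret prob_space "mu (fst p)" by (rule prob_space_mu)
    define B where "B M = (\<Union>n\<le>M. sec (A n) p)" for M :: nat
    have "(\<lambda>M. measure (mu (fst p)) (B M)) \<longlonglongrightarrow> measure (mu (fst p)) (\<Union>M. B M)"
      using meas[OF p] by (intro finite_Lim_measure_incseq) (fastforce simp: B_def incseq_def)+
    also have "(\<Union>M. B M) = sec (\<Union>n. A n) p" by (auto simp: B_def sec_def)
    finally have "\<forall>\<^sub>F M in sequentially. measure (mu (fst p)) (sec (\<Union>n. A n) p) - \<delta> / 2 < measure (mu (fst p)) (B M)"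
      using \<delta> by (intro order_tendstoD(1)) auto
    then obtain M where M: "measure (mu (fst p)) (sec (\<Union>n. A n) p) - \<delta> / 2 < measure (mu (fst p)) (B M)"
      by (auto dest: eventually_happens)
    \<comment> \<open>\<open>M\<close> is fixed first and loses less than \<delta>/2; then
      \<open>j\<close> is chosen so that the \<open>Suc M\<close> errors of size
      \<open>1 / real (Suc j)\<close> together lose less than \<delta>/2.\<close>
    obtain j where "inverse (real (Suc j)) < \<delta> / 2 / real (Suc M)"
      using reals_Archimedean[of "\<delta> / 2 / real (Suc M)"] \<delta> by auto
    then have j: "real (Suc M) * (1 / real (Suc j)) < \<delta> / 2"
      by (simp add: field_simps)
    have Km: "K n j p \<in> sets (mu (fst p))" for n
      using usc_measurable[OF K(1) p] .
    have "measure (mu (fst p)) (B M) - measure (mu (fst p)) (L M j p) = measure (mu (fst p)) (B M - L M j p)"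
      using meas[OF p] Km K(2)[OF p]
      by (intro finite_measure_Diff[symmetric]) (fastforce simp: B_def L_def)+
    also have "\<dots> \<le> measure (mu (fst p)) (\<Union>n\<le>M. sec (A n) p - K n j p)"
      using meas[OF p] Km by (intro finite_measure_mono) (auto simp: B_def L_def)
    also have "\<dots> \<le> (\<Sum>n\<le>M. measure (mu (fst p)) (sec (A n) p - K n j p))"
      using meas[OF p] Km by (intro finite_measure_subadditive_finite) auto
    also have "\<dots> \<le> (\<Sum>n\<le>M. 1 / real (Suc j))"
    proof (rule sum_mono)
      fix n
      have "measure (mu (fst p)) (sec (A n) p - K n j p) =
          measure (mu (fst p)) (sec (A n) p) - measure (mu (fst p)) (K n j p)"
        using meas[OF p] Km K(2)[OF p] by (intro finite_measure_Diff)
      then show "measure (mu (fst p)) (sec (A n) p - K n j p) \<le> 1 / real (Suc j)"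
        using K(3)[OF p, of n j] by linarith
    qed
    also have "\<dots> = real (Suc M) * (1 / real (Suc j))" by simp
    finally show ?thesis using M j by (intro exI[of _ M] exI[of _ j]) linarith
  qed
  show ?thesis
    unfolding pointwise_inner_def
  proof (intro exI[of _ "\<lambda>k. L (fst (prod_decode k)) (snd (prod_decode k))"] conjI allI ballI impI)
    fix p \<delta> assume "p \<in> topspace params" "(\<delta> :: real) > 0"
    from lim[OF this] obtain M j where
      "measure (mu (fst p)) (sec (\<Union>n. A n) p) - \<delta> < measure (mu (fst p)) (L M j p)" by blast
    then show "\<exists>k. measure (mu (fst p)) (sec (\<Union>n. A n) p) - \<delta> <
        measure (mu (fst p)) (L (fst (prod_decode k)) (snd (prod_decode k)) p)"
      by (intro exI[of _ "prod_encode (M, j)"]) simp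
  qed (use L sub in auto)
qed

text \<open>The section has measure below \<open>q\<close> iff, for some \<open>j\<close>, its
  approximation with error \<open>1 / real (Suc j)\<close> has measure below
  \<open>q - 1 / real (Suc j)\<close>. This transfers \<open>usc_measure_less\<close> to
  \<open>A\<close> at the same level.\<close>

lemma uniform_inner_measure_less:
  assumes A: "uniform_inner r A"
    and meas: "\<And>p. p \<in> topspace params \<Longrightarrow> sec A p \<in> sets (mu (fst p))" and r: "Field r \<noteq> {}"
  shows "borel_sigma params r {p \<in> topspace params. measure (mu (fst p)) (sec A p) < q}"
proof -
  have "\<exists>K. usc r K \<and> (\<forall>p\<in>topspace params. K p \<subseteq> sec A p \<and>
     measure (mu (fst p)) (sec A p) - 1 / real (Suc j) \<le> measure (mu (fst p)) (K p))" for j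
    using A unfolding uniform_inner_def by (metis of_nat_0_less_iff zero_less_Suc zero_less_divide_1_iff)
  then obtain K where K: "\<And>j. usc r (K j)"
    "\<And>j p. p \<in> topspace params \<Longrightarrow> K j p \<subseteq> sec A p"
    "\<And>j p. p \<in> topspace params \<Longrightarrow>
      measure (mu (fst p)) (sec A p) - 1 / real (Suc j) \<le> measure (mu (fst p)) (K j p)"
    by metis
  have "borel_sigma params r (\<Union>j. {p \<in> topspace params. measure (mu (fst p)) (K j p) < q - 1 / real (Suc j)})"
    by (intro borel_sigma_UN_nat metrizable_space_params usc_measure_less K)
  also have "(\<Union>j. {p \<in> topspace params. measure (mu (fst p)) (K j p) < q - 1 / real (Suc j)}) =
      {p \<in> topspace params. measure (mu (fst p)) (sec A p) < q}"
  proof (intro equalityI subsetI)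
    fix p assume "p \<in> (\<Union>j. {p \<in> topspace params. measure (mu (fst p)) (K j p) < q - 1 / real (Suc j)})"
    then obtain j where j: "p \<in> topspace params" "measure (mu (fst p)) (K j p) < q - 1 / real (Suc j)"
      by blast
    then have "measure (mu (fst p)) (sec A p) < q" using K(3)[OF j(1), of j] by linarith
    with j(1) show "p \<in> {p \<in> topspace params. measure (mu (fst p)) (sec A p) < q}" by simp
  next
    fix p assume p: "p \<in> {p \<in> topspace params. measure (mu (fst p)) (sec A p) < q}"
    interpret prob_space "mu (fst p)" by (rule prob_space_mu)
    obtain j where "inverse (real (Suc j)) < q - measure (mu (fst p)) (sec A p)"
      using reals_Archimedean[of "q - measure (mu (fst p)) (sec A p)"] p by auto
    moreover have "measure (mu (fst p)) (K j p) \<le> measure (mu (fst p)) (sec A p)"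
      using K(2) meas p by (intro finite_measure_mono) auto
    ultimately have "measure (mu (fst p)) (K j p) < q - 1 / real (Suc j)"
      unfolding inverse_eq_divide by linarith
    then show "p \<in> (\<Union>j. {p \<in> topspace params. measure (mu (fst p)) (K j p) < q - 1 / real (Suc j)})"
      using p by blast
  qed
  finally show ?thesis .
qed

lemma measure_sec_compl:
  assumes "borel_sigma ambient r S" "p \<in> topspace params"
  shows "measure (mu (fst p)) (sec (topspace ambient - S) p) = 1 - measure (mu (fst p)) (sec S p)"
proof -
  interpret prob_space "mu (fst p)" by (rule prob_space_mu)
  have "sec (topspace ambient - S) p = space (mu (fst p)) - sec S p"
    using assms(2) by (auto simp: sec_def topspace_ambient)
  then show ?thesis
    using prob_compl[OF sec_measurable[OF assms(1)[unfolded ambient_def] assms(2)]] by simp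
qed

lemma metrizable_space_ambient: "metrizable_space ambient"
  unfolding ambient_def by (rule metrizable_space_params_Z_omega)

text \<open>For each \<open>n\<close> an approximation to \<open>S n\<close> with error at most
  \<open>\<delta> n\<close> is selected in a \<open>\<Sigma>\<^sub>r\<close> way, and the selected
  sets are intersected. The hypothesis \<open>unif\<close> supplies the upper bounds on the measure
  of \<open>S n\<close> by which good indices are recognized.\<close>

lemma uniform_inner_INT:
  fixes S :: "nat \<Rightarrow> _" and r :: "nat rel" and \<rho> :: "nat \<Rightarrow> nat rel"
  assumes \<rho>: "\<And>n. \<rho> n <o r"
    and S: "\<And>n. borel_sigma ambient (\<rho> n) (S n)"
    and point: "\<And>n. pointwise_inner (\<rho> n) (S n)"
    and unif: "\<And>n. uniform_inner (\<rho> n) (topspace ambient - S n)"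
  shows "uniform_inner r (\<Inter>n. S n)"
  unfolding uniform_inner_def
proof (intro allI impI)
  fix \<epsilon> :: real assume \<epsilon>: "\<epsilon> > 0"
  let ?\<mu> = "\<lambda>p A. measure (mu (fst p)) A"
  have meas: "sec (S n) p \<in> sets (mu a)" if "p \<in> topspace params" for n p a
    using sec_measurable[OF S[of n, unfolded ambient_def] that] .
  have "\<exists>K :: nat \<Rightarrow> _. (\<forall>k. usc (\<rho> n) (K k)) \<and> (\<forall>p\<in>topspace params. (\<forall>k. K k p \<subseteq> sec (S n) p) \<and>
       (\<forall>\<delta>>0. \<exists>k. ?\<mu> p (sec (S n) p) - \<delta> < ?\<mu> p (K k p)))" for n
    using point[of n] unfolding pointwise_inner_def .
  then obtain K where K: "\<And>n k :: nat. usc (\<rho> n) (K n k)"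
    "\<And>n k p. p \<in> topspace params \<Longrightarrow> K n k p \<subseteq> sec (S n) p"
    "\<And>n p \<delta>. p \<in> topspace params \<Longrightarrow> \<delta> > 0 \<Longrightarrow> \<exists>k. ?\<mu> p (sec (S n) p) - \<delta> < ?\<mu> p (K n k p)"
    by metis
  \<comment> \<open>Geometric errors whose sum is \<epsilon>.\<close>
  define \<delta> where "\<delta> n = \<epsilon> * (1 / 2) ^ Suc n" for n :: nat
  have \<delta>: "\<delta> n > 0" for n using \<epsilon> by (simp add: \<delta>_def)
  define T where "T n k = {p \<in> topspace params. ?\<mu> p (sec (S n) p) - \<delta> n < ?\<mu> p (K n k p)}" for n k
  have T: "borel_sigma params r (T n k)" for n k
  proof -
    \<comment> \<open>A rational \<open>q\<close> separates the two sides: \<open>K n k p\<close>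
      has measure above \<open>q\<close>, and the section of \<open>S n\<close> has measure at most
      \<open>q + \<delta> n\<close>. The second condition is phrased through the complement of
      \<open>S n\<close>, whose threshold sets \<open>unif\<close> controls.\<close>
    have "borel_sigma params r (\<Union>q\<in>\<rat>. {p \<in> topspace params. ?\<mu> p (K n k p) > q} \<inter>
        (topspace params - {p \<in> topspace params. ?\<mu> p (sec (topspace ambient - S n) p) < 1 - (q + \<delta> n)}))"
    proof (intro borel_sigma_UN borel_sigma_Int metrizable_space_params countable_rat)
      show "Field r \<noteq> {}"
        using Field_nonempty_ordLeq[OF ordLess_imp_ordLeq[OF \<rho>] borel_sigma_Field[OF S]] .
      show "borel_sigma params r {p \<in> topspace params. ?\<mu> p (K n k p) > q}" for q
        using borel_sigma_strict_of_less[OF usc_measure_less[OF K(1)] \<rho>] .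
      show "borel_sigma params r
          (topspace params - {p \<in> topspace params. ?\<mu> p (sec (topspace ambient - S n) p) < 1 - (q + \<delta> n)})" for q
      proof (rule borel_sigma_compl[OF uniform_inner_measure_less[OF unif] \<rho>])
        fix p assume p: "p \<in> topspace params"
        have "sec (topspace ambient - S n) p = space (mu (fst p)) - sec (S n) p"
          using p by (auto simp: sec_def topspace_ambient)
        then show "sec (topspace ambient - S n) p \<in> sets (mu (fst p))"
          using meas[OF p] by (metis sets.compl_sets)
      qed (rule borel_sigma_Field[OF S])
    qed
    also have "(\<Union>q\<in>\<rat>. {p \<in> topspace params. ?\<mu> p (K n k p) > q} \<inter>
        (topspace params - {p \<in> topspace params. ?\<mu> p (sec (topspace ambient - S n) p) < 1 - (q + \<delta> n)})) = T n k"
    proof (intro equalityI subsetI)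
      fix p assume p: "p \<in> T n k"
      then obtain q where q: "q \<in> \<rat>" "?\<mu> p (sec (S n) p) - \<delta> n < q" "q < ?\<mu> p (K n k p)"
        using Rats_dense_in_real unfolding T_def by blast
      moreover have "p \<in> topspace params" using p by (simp add: T_def)
      moreover from this have "\<not> ?\<mu> p (sec (topspace ambient - S n) p) < 1 - (q + \<delta> n)"
        using measure_sec_compl[OF S, of p n] q(2) by linarith
      ultimately show "p \<in> (\<Union>q\<in>\<rat>. {p \<in> topspace params. ?\<mu> p (K n k p) > q} \<inter>
        (topspace params - {p \<in> topspace params. ?\<mu> p (sec (topspace ambient - S n) p) < 1 - (q + \<delta> n)}))"
        by blast
    next
      fix p assume "p \<in> (\<Union>q\<in>\<rat>. {p \<in> topspace params. ?\<mu> p (K n k p) > q} \<inter>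
        (topspace params - {p \<in> topspace params. ?\<mu> p (sec (topspace ambient - S n) p) < 1 - (q + \<delta> n)}))"
      then obtain q where "p \<in> topspace params" "?\<mu> p (K n k p) > q"
        "\<not> ?\<mu> p (sec (topspace ambient - S n) p) < 1 - (q + \<delta> n)" by blast
      then show "p \<in> T n k"
        using measure_sec_compl[OF S, of p n] unfolding T_def by simp
    qed
    finally show ?thesis .
  qed
  have cover: "topspace params \<subseteq> (\<Union>k. T n k)" for n
    using K(3)[OF _ \<delta>[of n], of _ n] unfolding T_def by blast
  \<comment> \<open>Reduction applies because \<open>\<rho> n\<close> is a nonempty order below
    \<open>r\<close>.\<close>
  have "\<exists>\<kappa> :: _ \<Rightarrow> nat. (\<forall>k. borel_sigma params r {p \<in> topspace params. \<kappa> p = k}) \<and>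
    (\<forall>p\<in>topspace params. p \<in> T n (\<kappa> p))" for n
  proof -
    obtain \<kappa> where "\<And>k. borel_sigma params r {p \<in> topspace params. \<kappa> p = k}"
      "\<And>p. p \<in> topspace params \<Longrightarrow> p \<in> T n (\<kappa> p)"
      using borel_sigma_reduction[OF metrizable_space_params \<rho>[of n] borel_sigma_Field[OF S] T[of n] cover[of n]]
      by blast
    then show ?thesis by (intro exI[of _ \<kappa>]) simp
  qed
  then have "\<exists>\<kappa> :: nat \<Rightarrow> _ \<Rightarrow> nat. \<forall>n. (\<forall>k. borel_sigma params r {p \<in> topspace params. \<kappa> n p = k}) \<and>
    (\<forall>p\<in>topspace params. p \<in> T n (\<kappa> n p))"
    by (intro choice allI)
  then obtain \<kappa> where \<kappa>: "\<And>n k :: nat. borel_sigma params r {p \<in> topspace params. \<kappa> n p = k}"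
    "\<And>n p. p \<in> topspace params \<Longrightarrow> p \<in> T n (\<kappa> n p)"
    by auto
  define L where "L p = (\<Inter>n. K n (\<kappa> n p) p)" for p
  have L: "usc r L"
    unfolding L_def
  proof (rule usc_INT)
    show "usc r (\<lambda>p. K n (\<kappa> n p) p)" for n
      by (rule usc_piecewise[of r "\<kappa> n" "K n", OF \<kappa>(1) usc_mono[OF K(1) \<rho>]])
  qed
  show "\<exists>K. usc r K \<and> (\<forall>p\<in>topspace params. K p \<subseteq> sec (\<Inter>n. S n) p \<and>
     ?\<mu> p (sec (\<Inter>n. S n) p) - \<epsilon> \<le> ?\<mu> p (K p))"
  proof (intro exI[of _ L] conjI ballI L)
    fix p assume p: "p \<in> topspace params"
    interpret prob_space "mu (fst p)" by (rule prob_space_mu)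
    show "L p \<subseteq> sec (\<Inter>n. S n) p"
      using K(2)[OF p] unfolding L_def sec_def by blast
    have Kmeas: "K n (\<kappa> n p) p \<in> sets (mu (fst p))" for n
      using usc_measurable[OF K(1) p] .
    \<comment> \<open>\<open>D n\<close> is what the selection for \<open>S n\<close> loses; a point
      of the intersection outside all \<open>D n\<close> lies in \<open>L p\<close>.\<close>
    define D where "D n = sec (S n) p - K n (\<kappa> n p) p" for n
    have D: "D n \<in> sets (mu (fst p))" "?\<mu> p (D n) \<le> \<delta> n" for n
    proof -
      show "D n \<in> sets (mu (fst p))" unfolding D_def using meas[OF p] Kmeas by (rule sets.Diff)
      have "?\<mu> p (D n) = ?\<mu> p (sec (S n) p) - ?\<mu> p (K n (\<kappa> n p) p)"
        unfolding D_def using meas[OF p] Kmeas K(2)[OF p] by (rule finite_measure_Diff)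
      then show "?\<mu> p (D n) \<le> \<delta> n" using \<kappa>(2)[OF p, of n] unfolding T_def by simp
    qed
    have sums: "\<delta> sums \<epsilon>"
      unfolding \<delta>_def using sums_mult[OF power_half_series, of \<epsilon>] by simp
    have summ: "summable (\<lambda>n. ?\<mu> p (D n))"
      by (rule summable_comparison_test[OF _ sums_summable[OF sums]]) (use D(2) in auto)
    have Im: "sec (\<Inter>n. S n) p \<in> sets (mu (fst p))"
    proof -
      have "sec (\<Inter>n. S n) p = (\<Inter>n. sec (S n) p)" by (auto simp: sec_def)
      then show ?thesis using meas[OF p] by auto
    qed
    have "?\<mu> p (sec (\<Inter>n. S n) p) \<le> ?\<mu> p (L p \<union> (\<Union>n. D n))"
    proof (rule finite_measure_mono)
      show "sec (\<Inter>n. S n) p \<subseteq> L p \<union> (\<Union>n. D n)"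
        unfolding sec_def L_def D_def by blast
      show "L p \<union> (\<Union>n. D n) \<in> sets (mu (fst p))"
        using D(1) usc_measurable[OF L p] by blast
    qed
    also have "\<dots> \<le> ?\<mu> p (L p) + ?\<mu> p (\<Union>n. D n)"
      using D(1) usc_measurable[OF L p] by (intro measure_Un_le) auto
    also have "?\<mu> p (\<Union>n. D n) \<le> (\<Sum>n. ?\<mu> p (D n))"
      using D(1) summ by (intro finite_measure_subadditive_countably) auto
    also have "(\<Sum>n. ?\<mu> p (D n)) \<le> (\<Sum>n. \<delta> n)"
      by (intro suminf_le D(2) summ sums_summable[OF sums])
    also have "(\<Sum>n. \<delta> n) = \<epsilon>" using sums by (rule sums_unique[symmetric])
    finally show "?\<mu> p (sec (\<Inter>n. S n) p) - \<epsilon> \<le> ?\<mu> p (L p)" by simp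
  qed
qed

text \<open>The two halves need a joint induction. For a union of sets \<open>A n\<close>, the
  second half for their complements says \<open>uniform_inner (\<rho> n) (A n)\<close>, which
  handles the union; both halves together feed \<open>uniform_inner_INT\<close>, which handles its
  complement.\<close>

theorem borel_sigma_inner_approximation:
  assumes "borel_sigma ambient r S"
  shows "pointwise_inner r S \<and> uniform_inner r (topspace ambient - S)"
  using assms
proof (induction rule: borel_sigma.induct)
  case (sigma_open r S)
  obtain C :: "nat \<Rightarrow> _" where C: "\<And>n. closedin ambient (C n)" "S = (\<Union>n. C n)"
    using openin_Union_closedin_sequence[OF metrizable_space_ambient sigma_open(2)] by metis
  have "pointwise_inner r (\<Union>n. C n)"
  proof (intro pointwise_inner_UN uniform_inner_closedin C sigma_open(1))
    fix n p assume p: "p \<in> topspace params"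
    have "borel_sigma ambient r (topspace ambient - C n)"
      using C(1)[of n] sigma_open(1) by (intro borel_sigma.sigma_open) auto
    then show "sec (C n) p \<in> sets (mu (fst p))"
      using closedin_subset[OF C(1)] p unfolding ambient_def by (rule sec_compl_measurable)
  qed
  moreover have "uniform_inner r (topspace ambient - S)"
    using sigma_open by (intro uniform_inner_closedin) auto
  ultimately show ?case using C(2) by simp
next
  case (sigma_union A r)
  then obtain \<rho> :: "nat \<Rightarrow> nat rel" where \<rho>: "\<And>n. \<rho> n <o r"
    "\<And>n. borel_sigma ambient (\<rho> n) (topspace ambient - A n)"
    "\<And>n. pointwise_inner (\<rho> n) (topspace ambient - A n)"
    "\<And>n. uniform_inner (\<rho> n) (topspace ambient - (topspace ambient - A n))"
    by metis
  have A: "A n \<subseteq> topspace ambient" for n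
    using sigma_union by blast
  then have AA: "topspace ambient - (topspace ambient - A n) = A n" for n
    by blast
  have "pointwise_inner r (\<Union>n. A n)"
  proof (rule pointwise_inner_UN)
    show "uniform_inner r (A n)" for n
      using uniform_inner_mono[OF \<rho>(4,1)] unfolding AA .
    show "sec (A n) p \<in> sets (mu (fst p))" if "p \<in> topspace params" for n p
      using \<rho>(2) A that unfolding ambient_def by (rule sec_compl_measurable)
  qed
  moreover have "uniform_inner r (\<Inter>n. topspace ambient - A n)"
    using \<rho> by (rule uniform_inner_INT)
  moreover have "(\<Inter>n. topspace ambient - A n) = topspace ambient - (\<Union>n. A n)"
    by blast
  ultimately show ?case by simp
qed

section \<open>Uniformization\<close>

primrec leftmost_prefix :: "(nat \<Rightarrow> int) set \<Rightarrow> nat \<Rightarrow> int list" where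
  "leftmost_prefix K 0 = []"
| "leftmost_prefix K (Suc n) = leftmost_prefix K n @
     [int (LEAST i. K \<inter> cyl (leftmost_prefix K n @ [int i]) \<noteq> {})]"

definition leftmost :: "(nat \<Rightarrow> int) set \<Rightarrow> nat \<Rightarrow> int" where
  "leftmost K n = leftmost_prefix K (Suc n) ! n"

lemma length_leftmost_prefix [simp]: "length (leftmost_prefix K n) = n"
  by (induction n) auto

lemma map_leftmost: "map (leftmost K) [0..<n] = leftmost_prefix K n"
  by (induction n) (auto simp: leftmost_def nth_append)

lemma cyl_append: "cyl (l @ [c]) = {g \<in> cyl l. g (length l) = c}"
  by (auto simp: cyl_def nth_append less_Suc_eq)

text \<open>Gives \<open>LEAST\<close> a witness: points of \<open>supp_mu a\<close> have
  nonnegative coordinates, so natural numbers suffice as candidates for the next entry.\<close>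

lemma meets_extension:
  assumes "K \<inter> cyl l \<noteq> {}" "K \<subseteq> supp_mu a"
  shows "\<exists>i. K \<inter> cyl (l @ [int i]) \<noteq> {}"
proof -
  obtain g where g: "g \<in> K" "g \<in> cyl l" using assms(1) by blast
  then have "0 \<le> g (length l)" using assms(2) by (auto simp: supp_mu_def)
  then have "g \<in> K \<inter> cyl (l @ [int (nat (g (length l)))])"
    using g by (simp add: cyl_append)
  then show ?thesis by blast
qed

lemma leftmost_prefix_meets:
  assumes "K \<noteq> {}" "K \<subseteq> supp_mu a"
  shows "K \<inter> cyl (leftmost_prefix K n) \<noteq> {}"
proof (induction n)
  case 0
  then show ?case using assms(1) by (auto simp: cyl_def)
next
  case (Suc n)
  from LeastI_ex[OF meets_extension[OF Suc assms(2)]] show ?case by simp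
qed

text \<open>Every cylinder around \<open>leftmost K\<close> meets \<open>K\<close>, and
  \<open>K\<close> is closed.\<close>

lemma leftmost_mem:
  assumes K: "K \<noteq> {}" "K \<subseteq> supp_mu a" "closed K"
  shows "leftmost K \<in> K"
proof (rule ccontr)
  assume "leftmost K \<notin> K"
  then obtain n where "cyl (map (leftmost K) [0..<n]) \<subseteq> - K"
    using open_contains_cyl[of "- K" "leftmost K"] K(3) by (auto simp: open_Compl)
  then show False
    using leftmost_prefix_meets[OF K(1,2), of n] by (auto simp: map_leftmost)
qed

lemma leftmost_mem_cyl: "leftmost K \<in> cyl l \<longleftrightarrow> leftmost_prefix K (length l) = l"
proof -
  have "g \<in> cyl l \<longleftrightarrow> map g [0..<length l] = l" for g
    unfolding cyl_def list_eq_iff_nth_eq[of _ l] by simp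
  then show ?thesis by (simp only: map_leftmost)
qed

text \<open>Cylinders are clopen, so missing one means being contained in an open set; at a higher
  class this condition and its negation are both available.\<close>

lemma usc_meets_cyl:
  assumes K: "usc r' K" and r': "r' <o r"
  shows "borel_sigma params r {p \<in> topspace params. K p \<inter> cyl l \<noteq> {}}"
    and "borel_sigma params r (topspace params - {p \<in> topspace params. K p \<inter> cyl l \<noteq> {}})"
proof -
  have *: "borel_sigma params r' {p \<in> topspace params. K p \<subseteq> - cyl l}"
    using K closed_cyl[of l] unfolding usc_def by (auto simp: open_Compl)
  have "topspace params - {p \<in> topspace params. K p \<subseteq> - cyl l} =
      {p \<in> topspace params. K p \<inter> cyl l \<noteq> {}}" by blast
  with borel_sigma_compl[OF * r']
  show "borel_sigma params r {p \<in> topspace params. K p \<inter> cyl l \<noteq> {}}" by simp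
  have "topspace params - {p \<in> topspace params. K p \<inter> cyl l \<noteq> {}} =
      {p \<in> topspace params. K p \<subseteq> - cyl l}" by blast
  with borel_sigma_mono_less[OF * r']
  show "borel_sigma params r (topspace params - {p \<in> topspace params. K p \<inter> cyl l \<noteq> {}})" by simp
qed

text \<open>Induction on the prefix length: the next entry is \<open>i\<close> iff
  \<open>K p\<close> meets the extension by \<open>i\<close> and none of the finitely many
  extensions by smaller naturals.\<close>

lemma usc_leftmost_prefix:
  assumes K: "usc r' K" and r': "r' <o r"
  shows "borel_sigma params r {p \<in> topspace params. K p \<noteq> {} \<and> leftmost_prefix (K p) n = l}"
proof (induction n arbitrary: l)
  case 0
  have "{p \<in> topspace params. K p \<inter> cyl [] \<noteq> {}} = {p \<in> topspace params. K p \<noteq> {}}"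
    by (simp add: cyl_def)
  then have "borel_sigma params r {p \<in> topspace params. K p \<noteq> {}}"
    using usc_meets_cyl(1)[OF K r', of "[]"] by simp
  then show ?case
    using borel_sigma_empty[OF borel_sigma_Field] by (cases "l = []") auto
next
  case (Suc n)
  have r: "Field r \<noteq> {}" using borel_sigma_Field[OF Suc] .
  let ?H = "\<lambda>l. {p \<in> topspace params. K p \<inter> cyl l \<noteq> {}}"
  show ?case
  proof (cases "\<exists>l' i. l = l' @ [int i]")
    case True
    then obtain l' i where l: "l = l' @ [int i]" by blast
    have "borel_sigma params r ({p \<in> topspace params. K p \<noteq> {} \<and> leftmost_prefix (K p) n = l'} \<inter>
        (?H (l' @ [int i]) \<inter> (topspace params \<inter> (\<Inter>j\<in>{..<i}. topspace params - ?H (l' @ [int j])))))"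
      by (intro borel_sigma_Int borel_sigma_INT metrizable_space_params Suc usc_meets_cyl[OF K r'] r) simp
    also have "{p \<in> topspace params. K p \<noteq> {} \<and> leftmost_prefix (K p) n = l'} \<inter>
        (?H (l' @ [int i]) \<inter> (topspace params \<inter> (\<Inter>j\<in>{..<i}. topspace params - ?H (l' @ [int j])))) =
        {p \<in> topspace params. K p \<noteq> {} \<and> leftmost_prefix (K p) (Suc n) = l}" (is "?A = ?B")
    proof (intro equalityI subsetI)
      fix p assume p: "p \<in> ?A"
      then have hit: "K p \<inter> cyl (l' @ [int i]) \<noteq> {}" and "\<forall>j<i. K p \<inter> cyl (l' @ [int j]) = {}"
        by blast+
      then have "(LEAST i. K p \<inter> cyl (l' @ [int i]) \<noteq> {}) = i"
        by (intro Least_equality) (auto simp: not_less[symmetric])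
      with p hit show "p \<in> ?B" by (simp add: l)
    next
      fix p assume p: "p \<in> ?B"
      define M where "M j \<longleftrightarrow> K p \<inter> cyl (l' @ [int j]) \<noteq> {}" for j
      have l': "leftmost_prefix (K p) n = l'" and i: "(LEAST i. M i) = i"
        using p by (auto simp: l M_def)
      have "K p \<inter> cyl l' \<noteq> {}" "K p \<subseteq> supp_mu (fst p)"
        using leftmost_prefix_meets[of "K p" "fst p" n] p K l' unfolding usc_def by auto
      then have "\<exists>i. M i" unfolding M_def by (rule meets_extension)
      then have "M i" "\<And>j. j < i \<Longrightarrow> \<not> M j"
        using LeastI_ex[of M] not_less_Least[of _ M] i by auto
      then show "p \<in> ?A" using p l' unfolding M_def by blast
    qed
    finally show ?thesis .
  next
    case False
    \<comment> \<open>A prefix of positive length always ends in the image of a natural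
      number.\<close>
    then have "{p \<in> topspace params. K p \<noteq> {} \<and> leftmost_prefix (K p) (Suc n) = l} = {}" by auto
    then show ?thesis using borel_sigma_empty[OF r] by metis
  qed
qed

text \<open>The pieces \<open>A n\<close> of \<open>V\<close> contain countably many compact-valued
  maps \<open>K n j\<close> of classes below \<open>r\<close>. Emptiness of their values is decided
  within class \<open>r\<close> on both sides, so the first nonempty value can be selected.\<close>

theorem borel_sigma_positive_measure_uniformization:
  fixes r r1 :: "nat rel"
  assumes r1: "r1 <o r" "Field r1 \<noteq> {}" and V: "borel_sigma ambient r V"
  obtains f where "sigma_measurable_partial params Z_omega r f"
    "\<And>p g. f p = Some g \<Longrightarrow> (p, g) \<in> V \<and> g \<in> supp_mu (fst p)"
    "\<And>p. p \<in> topspace params \<Longrightarrow> measure (mu (fst p)) (sec V p) > 0 \<Longrightarrow> p \<in> dom f"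
proof -
  obtain A where A: "V = (\<Union>n::nat. A n)" "\<And>n. A n \<subseteq> topspace ambient"
    "\<And>n. \<exists>r' :: nat rel. r' <o r \<and> borel_sigma ambient r' (topspace ambient - A n)"
    using borel_sigma_limit_rep[OF metrizable_space_ambient r1 V] by metis
  obtain \<rho> :: "nat \<Rightarrow> nat rel" where \<rho>: "\<And>n. \<rho> n <o r"
    "\<And>n. borel_sigma ambient (\<rho> n) (topspace ambient - A n)"
    using A(3) by metis
  have "topspace ambient - (topspace ambient - A n) = A n" for n
    using A(2) by blast
  then have "uniform_inner (\<rho> n) (A n)" for n
    using borel_sigma_inner_approximation[OF \<rho>(2)] by metis
  then have "\<exists>K. usc (\<rho> n) K \<and> (\<forall>p\<in>topspace params. K p \<subseteq> sec (A n) p \<and>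
     measure (mu (fst p)) (sec (A n) p) - 1 / real (Suc j) \<le> measure (mu (fst p)) (K p))" for n j
    unfolding uniform_inner_def by (metis of_nat_0_less_iff zero_less_Suc zero_less_divide_1_iff)
  then obtain K where K: "\<And>n j. usc (\<rho> n) (K n j)"
    "\<And>n j p. p \<in> topspace params \<Longrightarrow> K n j p \<subseteq> sec (A n) p"
    "\<And>n j p. p \<in> topspace params \<Longrightarrow>
      measure (mu (fst p)) (sec (A n) p) - 1 / real (Suc j) \<le> measure (mu (fst p)) (K n j p)"
    by metis
  define C where "C c = K (fst (prod_decode c)) (snd (prod_decode c))" for c
  \<comment> \<open>\<open>cyl []\<close> is the whole space, so this expresses nonemptiness in a
    form to which \<open>usc_meets_cyl\<close> applies.\<close>
  define E where "E c = {p \<in> topspace params. C c p \<inter> cyl [] \<noteq> {}}" for c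
  have C: "usc (\<rho> (fst (prod_decode c))) (C c)" for c
    unfolding C_def by (rule K(1))
  have E: "borel_sigma params r (E c)" "borel_sigma params r (topspace params - E c)" for c
    unfolding E_def using usc_meets_cyl[OF C \<rho>(1)] by auto
  have E_iff: "p \<in> E c \<longleftrightarrow> p \<in> topspace params \<and> C c p \<noteq> {}" for p c
    by (simp add: E_def cyl_def)
  define first where "first p = (LEAST c. p \<in> E c)" for p
  define f where "f p = (if \<exists>c. p \<in> E c then Some (leftmost (C (first p) p)) else None)" for p
  have first: "p \<in> E (first p)" if "\<exists>c. p \<in> E c" for p
    unfolding first_def using that by (rule LeastI_ex)
  have first_eq: "first p = c" if "p \<in> E c" "\<forall>i<c. p \<notin> E i" for p c
    unfolding first_def using that by (intro Least_equality) (auto simp: not_less[symmetric])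
  have mem: "leftmost (C c p) \<in> C c p" if "p \<in> E c" for p c
    using that C[of c] unfolding E_iff usc_def by (intro leftmost_mem[of _ "fst p"]) auto
  have meas: "borel_sigma params r {p. \<exists>y. f p = Some y \<and> y \<in> U}" if U: "openin Z_omega U" for U
  proof -
    \<comment> \<open>The value lies in \<open>U\<close> iff some cylinder inside \<open>U\<close>
      contains it, that is, iff it has a prefix \<open>l\<close> with
      \<open>cyl l \<subseteq> U\<close>; the other factor fixes \<open>c\<close> as the first index
      with a nonempty value.\<close>
    have "borel_sigma params r (\<Union>(c, l)\<in>{(c, l). cyl l \<subseteq> U}. {p \<in> E c. \<forall>i<c. p \<notin> E i} \<inter>
        {p \<in> topspace params. C c p \<noteq> {} \<and> leftmost_prefix (C c p) (length l) = l})"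
      using borel_sigma_first_index[OF metrizable_space_params E] usc_leftmost_prefix[OF C \<rho>(1)]
      by (intro borel_sigma_UN metrizable_space_params borel_sigma_Field[OF V])
        (auto intro!: borel_sigma_Int metrizable_space_params)
    also have "(\<Union>(c, l)\<in>{(c, l). cyl l \<subseteq> U}. {p \<in> E c. \<forall>i<c. p \<notin> E i} \<inter>
        {p \<in> topspace params. C c p \<noteq> {} \<and> leftmost_prefix (C c p) (length l) = l}) =
        {p. \<exists>y. f p = Some y \<and> y \<in> U}" (is "?A = ?B")
    proof (intro equalityI subsetI)
      fix p assume "p \<in> ?A"
      then obtain c l where cl: "cyl l \<subseteq> U" "p \<in> E c" "\<forall>i<c. p \<notin> E i"
        "leftmost_prefix (C c p) (length l) = l" by auto
      then have "f p = Some (leftmost (C c p))"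
        using first_eq[OF cl(2,3)] by (auto simp: f_def)
      moreover have "leftmost (C c p) \<in> U"
        using cl(1,4) leftmost_mem_cyl by blast
      ultimately show "p \<in> ?B" by blast
    next
      fix p assume "p \<in> ?B"
      then obtain y where y: "f p = Some y" "y \<in> U" by blast
      then have ex: "\<exists>c. p \<in> E c" and y': "y = leftmost (C (first p) p)"
        by (auto simp: f_def split: if_splits)
      obtain n where n: "cyl (map y [0..<n]) \<subseteq> U"
        using open_contains_cyl[of U y] U y(2) by (auto simp: Z_omega_eq simp flip: open_openin)
      have "y \<in> cyl (map y [0..<n])" by (simp add: mem_cyl_restrict)
      then have "leftmost_prefix (C (first p) p) (length (map y [0..<n])) = map y [0..<n]"
        using leftmost_mem_cyl y' by blast
      moreover have "\<forall>i<first p. p \<notin> E i"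
        unfolding first_def using not_less_Least by blast
      ultimately show "p \<in> ?A"
        using n first[OF ex] E_iff by (auto intro!: exI[of _ "first p"] exI[of _ "map y [0..<n]"])
    qed
    finally show ?thesis .
  qed
  show thesis
  proof (rule that)
    show "sigma_measurable_partial params Z_omega r f"
      unfolding sigma_measurable_partial_def using meas
      by (auto simp: f_def E_iff split: if_splits)
    show "(p, g) \<in> V \<and> g \<in> supp_mu (fst p)" if "f p = Some g" for p g
    proof -
      have ex: "\<exists>c. p \<in> E c" and g: "g = leftmost (C (first p) p)"
        using that by (auto simp: f_def split: if_splits)
      have p: "p \<in> E (first p)" using first[OF ex] .
      have "g \<in> C (first p) p" using mem[OF p] g by simp
      have tp: "p \<in> topspace params" using p E_iff by blast
      have "C (first p) p \<subseteq> sec V p"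
        using K(2)[OF tp, of "fst (prod_decode (first p))" "snd (prod_decode (first p))"]
        by (fastforce simp: A(1) C_def sec_def)
      moreover have "C (first p) p \<subseteq> supp_mu (fst p)"
        using C[of "first p"] tp by (simp add: usc_def)
      ultimately show ?thesis
        using \<open>g \<in> C (first p) p\<close> by (auto simp: sec_def)
    qed
    show "p \<in> dom f" if p: "p \<in> topspace params" and pos: "measure (mu (fst p)) (sec V p) > 0" for p
    proof -
      interpret prob_space "mu (fst p)" by (rule prob_space_mu)
      have Am: "sec (A n) p \<in> sets (mu (fst p))" for n
        using sec_compl_measurable[OF \<rho>(2)[of n, unfolded ambient_def] A(2)[of n, unfolded ambient_def] p] .
      \<comment> \<open>By countable subadditivity some piece is not null; an approximation to it
        with error below its measure is then nonempty.\<close>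
      have "\<exists>n. measure (mu (fst p)) (sec (A n) p) > 0"
      proof (rule ccontr)
        assume "\<not> ?thesis"
        then have z: "measure (mu (fst p)) (sec (A n) p) = 0" for n
          using measure_nonneg[of "mu (fst p)" "sec (A n) p"] by (metis less_eq_real_def)
        have "sec V p = (\<Union>n. sec (A n) p)" by (auto simp: A(1) sec_def)
        also have "measure (mu (fst p)) \<dots> \<le> (\<Sum>n. measure (mu (fst p)) (sec (A n) p))"
          using Am z by (intro finite_measure_subadditive_countably) auto
        finally have "measure (mu (fst p)) (sec V p) \<le> (\<Sum>n. measure (mu (fst p)) (sec (A n) p))" .
        with z pos show False by simp
      qed
      then obtain n where n: "measure (mu (fst p)) (sec (A n) p) > 0" by blast
      then obtain j where "inverse (real (Suc j)) < measure (mu (fst p)) (sec (A n) p)"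
        using reals_Archimedean by blast
      then have "measure (mu (fst p)) (K n j p) > 0"
        using K(3)[OF p, of n j] by (simp add: inverse_eq_divide)
      then have "K n j p \<noteq> {}" by auto
      then have "p \<in> E (prod_encode (n, j))" by (simp add: E_iff C_def p)
      then show ?thesis by (auto simp: f_def)
    qed
  qed
qed

section \<open>The diagonal argument\<close>

lemma topspace_graph_space:
  "topspace (prod_topology Zpos_omega (prod_topology Cantor Z_omega)) = topspace Zpos_omega \<times> UNIV \<times> UNIV"
  by simp

text \<open>\<open>(p, g)\<close> is in the graph iff \<open>p\<close> is in the domain and \<open>g\<close> lies in every cylinder that
  contains \<open>f p\<close>.\<close>

lemma sigma_measurable_partial_graph:
  fixes f :: "(nat \<Rightarrow> int) \<times> (nat \<Rightarrow> bool) \<Rightarrow> (nat \<Rightarrow> int) option"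
  assumes f: "sigma_measurable_partial params Z_omega r f"
  shows "\<exists>P Q. borel_pi (prod_topology Zpos_omega (prod_topology Cantor Z_omega)) r P \<and>
    borel_pi (prod_topology Zpos_omega (prod_topology Cantor Z_omega)) r Q \<and>
    {(a, x, g). f (a, x) = Some g} = P - Q"
proof -
  let ?T = "prod_topology Zpos_omega (prod_topology Cantor Z_omega)"
  have T: "metrizable_space ?T"
    using metrizable_space_Zpos_omega metrizable_space_Cantor metrizable_space_Z_omega
    by (simp add: metrizable_space_prod_topology)
  define h :: "(nat \<Rightarrow> int) \<times> (nat \<Rightarrow> bool) \<times> (nat \<Rightarrow> int) \<Rightarrow> (nat \<Rightarrow> int) \<times> (nat \<Rightarrow> bool)"
    where "h t = (fst t, fst (snd t))" for t
  have h: "continuous_map ?T params h"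
    unfolding h_def[abs_def] params_def
    by (intro continuous_map_pairedI continuous_map_fst
        continuous_map_compose[OF continuous_map_snd continuous_map_fst, unfolded comp_def])
  have proj: "continuous_map ?T Z_omega (\<lambda>t. snd (snd t))"
    by (rule continuous_map_compose[OF continuous_map_snd continuous_map_snd, unfolded comp_def])
  have pre: "borel_sigma params r {p. \<exists>y. f p = Some y \<and> y \<in> U}" if "open U" for U
  proof -
    have "openin Z_omega U" using that by (simp add: Z_omega_eq flip: open_openin)
    then show ?thesis using f by (simp add: sigma_measurable_partial_def)
  qed
  have "dom f \<subseteq> topspace params"
    using f by (simp add: sigma_measurable_partial_def)
  then have dom: "p \<in> topspace params" if "f p = Some y" for p y
    using that by (auto dest: domI)
  have r: "Field r \<noteq> {}" using borel_sigma_Field[OF pre[OF open_UNIV]] .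
  define D where "D = {t \<in> topspace ?T. h t \<in> {p. \<exists>y. f p = Some y \<and> y \<in> UNIV}}"
  \<comment> \<open>The points over the domain whose last coordinate is separated from the value of
    \<open>f\<close> by a cylinder; the graph is \<open>D - N\<close>.\<close>
  define N where "N = (\<Union>l. {t \<in> topspace ?T. h t \<in> {p. \<exists>y. f p = Some y \<and> y \<in> cyl l}} \<inter>
      {t \<in> topspace ?T. snd (snd t) \<in> - cyl l})"
  have D: "borel_sigma ?T r D"
    unfolding D_def by (intro borel_sigma_vimage[OF h] pre open_UNIV)
  have "openin Z_omega (- cyl l)" for l
    using closed_cyl[of l] by (simp add: Z_omega_eq open_Compl flip: open_openin)
  then have N: "borel_sigma ?T r N"
    unfolding N_def using r
    by (intro borel_sigma_UN borel_sigma_Int T countableI_type borel_sigma_vimage[OF h]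
        borel_sigma_vimage[OF proj] pre open_cyl borel_sigma.sigma_open)
  have compl: "topspace ?T - (topspace ?T - B) = B" if "borel_sigma ?T r B" for B
    using borel_sigma_subset[OF that] by blast
  have D_iff: "(a, x, g) \<in> D \<longleftrightarrow> (\<exists>y. f (a, x) = Some y)" for a x g
    unfolding D_def h_def topspace_graph_space
    using dom fst_params by fastforce
  have sep: "y = g" if "\<And>l. y \<in> cyl l \<Longrightarrow> g \<in> cyl l" for y g
  proof
    fix i
    have "g \<in> cyl (map y [0..<Suc i])"
      using that[of "map y [0..<Suc i]"] mem_cyl_restrict[of y y] by blast
    then show "y i = g i" unfolding mem_cyl_restrict by auto
  qed
  have N_iff: "(a, x, g) \<in> N \<longleftrightarrow> y \<noteq> g" if y: "f (a, x) = Some y" for a x g y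
  proof -
    have "a \<in> topspace Zpos_omega" using fst_params[OF dom[OF y]] by simp
    then show ?thesis
      using y sep[of y g] unfolding N_def h_def topspace_graph_space by auto
  qed
  \<comment> \<open>Both \<open>D\<close> and \<open>N\<close> are \<open>\<Sigma>\<^sub>r\<close>,
    so \<open>D - N\<close> is rewritten as a difference of their complements.\<close>
  have "{(a, x, g). f (a, x) = Some g} = (topspace ?T - N) - (topspace ?T - D)" (is "?G = ?R")
  proof (intro equalityI subsetI)
    fix t assume "t \<in> ?G"
    moreover obtain a x g where t: "t = (a, x, g)" by (cases t)
    ultimately have "f (a, x) = Some g" by simp
    then have "t \<in> D" "t \<notin> N" using D_iff N_iff t by auto
    then show "t \<in> ?R" using borel_sigma_subset[OF D] by blast
  next
    fix t assume "t \<in> ?R"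
    moreover obtain a x g where t: "t = (a, x, g)" by (cases t)
    ultimately have "(a, x, g) \<in> D" "(a, x, g) \<notin> N" by auto
    then show "t \<in> ?G" using D_iff N_iff t by auto
  qed
  moreover have "borel_pi ?T r (topspace ?T - N)" "borel_pi ?T r (topspace ?T - D)"
    unfolding borel_pi_def compl[OF N] compl[OF D] using N D by auto
  ultimately show ?thesis by blast
qed

theorem theorem4p1:
  fixes r :: "nat rel"
  assumes "Well_order r"
    and "\<exists>i j. i \<in> Field r \<and> j \<in> Field r \<and> i \<noteq> j"
  shows "\<exists>f :: (nat \<Rightarrow> int) \<times> (nat \<Rightarrow> bool) \<Rightarrow> (nat \<Rightarrow> int) option.
     sigma_measurable_partial (prod_topology Zpos_omega Cantor) Z_omega r f \<and>
     (\<exists>P Q. borel_pi (prod_topology Zpos_omega (prod_topology Cantor Z_omega)) r P \<and>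
            borel_pi (prod_topology Zpos_omega (prod_topology Cantor Z_omega)) r Q \<and>
            {(a, x, g). f (a, x) = Some g} = P - Q) \<and>
     (\<forall>a x g. a \<in> topspace Zpos_omega \<and> x \<in> topspace Cantor \<and> f (a, x) = Some g
        \<longrightarrow> g \<in> supp_mu a) \<and>
     (\<forall>a \<in> topspace Zpos_omega. \<forall>S. borel_pi (prod_topology Cantor Z_omega) r S \<and>
        {(x, g). f (a, x) = Some g} \<subseteq> S
        \<longrightarrow> (\<exists>x \<in> topspace Cantor. emeasure (mu a) {g. (x, g) \<in> S} > 0))"
proof -
  let ?Y = "prod_topology Cantor Z_omega"
  obtain r1 :: "nat rel" where r1: "r1 <o r" "Field r1 \<noteq> {}"
    using ex_smaller_nonempty_order[OF assms(1)] assms(2) by metis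
  have "metrizable_space ?Y"
    using metrizable_space_Cantor metrizable_space_Z_omega
    by (simp add: metrizable_space_prod_topology)
  moreover have "second_countable ?Y"
    by (simp add: Cantor_eq Z_omega_eq second_countable_euclidean)
  moreover have "Field r \<noteq> {}" using assms(2) by blast
  ultimately obtain W where W: "borel_sigma (prod_topology Cantor ?Y) r W"
    "\<And>S. borel_sigma ?Y r S \<Longrightarrow> \<exists>x. S = {z. (x, z) \<in> W}"
    using ex_universal_borel_sigma[of ?Y r] assms(1) by metis
  \<comment> \<open>The diagonal: \<open>x\<close> serves both as a code and as the first coordinate
    of a point tested against the coded set.\<close>
  define \<Delta> :: "((nat \<Rightarrow> int) \<times> (nat \<Rightarrow> bool)) \<times> (nat \<Rightarrow> int) \<Rightarrow> _"
    where "\<Delta> t = (snd (fst t), snd (fst t), snd t)" for t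
  have \<Delta>: "continuous_map ambient (prod_topology Cantor ?Y) \<Delta>"
    unfolding \<Delta>_def[abs_def] ambient_def params_def
    by (intro continuous_map_pairedI continuous_map_snd
        continuous_map_compose[OF continuous_map_fst continuous_map_snd, unfolded comp_def])
  define V where "V = {t \<in> topspace ambient. \<Delta> t \<in> W}"
  have V: "borel_sigma ambient r V"
    unfolding V_def by (rule borel_sigma_vimage[OF \<Delta> W(1)])
  obtain f where f: "sigma_measurable_partial params Z_omega r f"
    "\<And>p g. f p = Some g \<Longrightarrow> (p, g) \<in> V \<and> g \<in> supp_mu (fst p)"
    "\<And>p. p \<in> topspace params \<Longrightarrow> measure (mu (fst p)) (sec V p) > 0 \<Longrightarrow> p \<in> dom f"
    using borel_sigma_positive_measure_uniformization[OF r1 V] by metis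
  have "\<exists>x\<in>topspace Cantor. emeasure (mu a) {g. (x, g) \<in> S} > 0"
    if a: "a \<in> topspace Zpos_omega" and S: "borel_pi ?Y r S" and graph: "{(x, g). f (a, x) = Some g} \<subseteq> S"
    for a S
  proof -
    interpret prob_space "mu a" by (rule prob_space_mu)
    \<comment> \<open>\<open>x\<close> codes the complement of \<open>S\<close>, so the section of
      \<open>V\<close> at \<open>(a, x)\<close> is the complement of the section of \<open>S\<close>
      at \<open>x\<close>.\<close>
    obtain x where x: "topspace ?Y - S = {z. (x, z) \<in> W}"
      using W(2) S unfolding borel_pi_def by blast
    have p: "(a, x) \<in> topspace params" using a by (simp add: params_def)
    have Sx: "sec V (a, x) = - sec S x"
      using x p by (auto simp: V_def \<Delta>_def sec_def topspace_ambient set_eq_iff)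
    have "sec V (a, x) \<in> sets (mu a)"
      using V p unfolding ambient_def by (rule sec_measurable)
    then have meas: "sec S x \<in> sets (mu a)"
      unfolding Sx by (metis Compl_eq_Diff_UNIV double_complement sets.compl_sets space_mu)
    have "measure (mu a) (sec S x) > 0"
    proof (rule ccontr)
      assume "\<not> ?thesis"
      then have "measure (mu a) (sec S x) = 0"
        using measure_nonneg[of "mu a" "sec S x"] by linarith
      then have "measure (mu a) (sec V (a, x)) = 1"
        using prob_compl[OF meas] by (simp add: Sx Compl_eq_Diff_UNIV)
      then obtain g where g: "f (a, x) = Some g"
        using f(3)[OF p] by auto
      then have "g \<in> sec V (a, x)" using f(2) by (simp add: sec_def)
      moreover have "g \<in> sec S x" using graph g by (auto simp: sec_def)
      ultimately show False using Sx by blast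
    qed
    then show ?thesis
      unfolding sec_def emeasure_eq_measure by (auto intro!: exI[of _ x])
  qed
  moreover have "g \<in> supp_mu a" if "f (a, x) = Some g" for a x g
    using f(2)[OF that] by simp
  ultimately show ?thesis
    using f(1) sigma_measurable_partial_graph[OF f(1)] unfolding params_def
    by (intro exI[of _ f]) blast
qed

end
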